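(* Let $E$ be a real vector space of dimension $2$, $D\subset P(E)\times P(E)$ nonempty and open, and let $B:D\to P(E)$ satisfy hypotheses (H1)–(H7) listed in the context; let $U\subsetneqq P(E)$ be the nonempty connected open set with $D=U\times U$. Consider the equality $$\beta(|x,y|)=\epsilon_U(x,y;u,v)\;d_q(x,y;u,v)\;\sigma_q^{\beta(|u,v|)}(B(x,y)) \qquad (\ast)$$ for $x,y,u,v\in U$, $x\neq y$, $u\neq v$, $q\in P(E)$, $B(u,v)\ne q\ne B(x,y)$. Prescribe $u_0,v_0\in U$, $u_0\neq v_0$, and $\beta(|u_0,v_0|)=\beta_0\in E\setminus\{0\}$ with $B(u_0,v_0)=P(\mathbf R\beta_0)$. Then $(\ast)$ with $u=u_0$, $v=v_0$ may be used to define $\beta(|x,y|)$ for all $x\neq y$ in $U$ (and in the same way, with $(x,y)$ replaced by $(u,v)$, to define $\beta(|u,v|)$ for all $u\ne v$ in $U$); the values $\beta(|x,y|)$ and $\beta(|u,v|)$ found in this way verify the equality $(\ast)$ for all $x\ne y$, $u\neq v$ in $U$ and $q$ with $B(u,v)\neq q\neq B(x,y)$. And for this ($E$-valued) measure $\beta$ on $U$ we have $B_\beta=B$.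
   Context: $P(E)$ is the projective line of $E$. The cross-ratio is determined by $[P(\mathbf R(e_1+xe_2)),P(\mathbf R(e_1+e_2)),P(\mathbf Re_1),P(\mathbf Re_2)]=x$ for $x\in\mathbf R$ and linearly independent $e_1,e_2\in E$, extended by continuity, with values in $\mathbf R\cup\{\infty\}$, to all quadruples no three entries of which coincide (set $\underline D$). $C_0$, $C_\infty$ denote the subsets of $\underline D$ where the cross-ratio is $\neq0$, respectively $\neq\infty$. Hypotheses on $B$: (H1) $(p,q)\in D\Rightarrow(q,p)\in D$. (H2) $(p,q),(r,s)\in D\Rightarrow(p,r)\in D$. (H3) $B(p,q)=B(q,p)$ on $D$. (H4) $p\ne B(p,q)\ne q$ for $(p,q)\in D$, $p\neq q$. (H5) For $(p,q)\in D$, $p\ne q$, let $|p,q|$ be the closed arc of extremities $p,q$ with $B(p,q)\in\mathrm{int}\,|p,q|$; then for all $r\ne s$ in $\mathrm{int}\,|p,q|$ we have $(r,s)\in D$ and $|r,s|\subset|p,q|$. (H6) $[B(p,q),B(p,r),B(p,s),B(r,s)]=[B(p,q),B(q,r),B(q,s),B(r,s)]$ whenever both sides are in $C_0\cap C_\infty$. (H7) $B$ is continuous on $D$. Under these hypotheses it is known that $D=U\times U$ for a nonempty open connected $U\subsetneqq P(E)$ with $|p,q|\subset U$ for all $p\ne q$ in $U$, and $B(q,q)=q$ for $q\in U$. Notation: $r_q(a,b,c)=[B(a,c),B(b,c),B(a,b),q]$ and $d_q(x,y;u,v)=r_q(u,x,v)-r_q(u,y,v)$, for $a,b,c,x,y,u,v\in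 U$, $q\in P(E)$. $\epsilon_U(p,q;r,s)=\mathrm{sgn}([p,r,s,k]-[q,r,s,k])$ for $p,q,r,s\in U$ and any $k\in P(E)\setminus U$ (independent of $k$). For $P(L)\in P(E)$ and $e\in E\setminus L$, $\sigma^e_{P(L)}:P(E)\setminus\{P(L)\}\to E$ is the map characterized by $\sigma^e_{P(L)}(P(L_2))\in L_2$ and $\sigma^e_{P(L)}(P(L_2))-e\in L$. The barycentric map of a measure $\beta$ with $\beta(|x,y|)\neq0$ is $B_\beta(x,y)=P(\mathbf R\cdot\beta(|x,y|))$ for $x\ne y$ in $U$, and $B_\beta(x,x)=x$. *)

theory Defs
  imports "HOL-Analysis.Analysis"
begin

definition proj_line :: "'a::real_vector set set" where
  "proj_line = {L. subspace L \<and> dim L = 1}"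

text \<open>
  The quotient topology of \<open>E - {0}\<close>, where the canonical topology of the two-dimensional
  space \<open>E\<close> is transported from the plane by linear coordinates (all choices of coordinates
  give the same topology).
\<close>

definition proj_topology :: "'a::real_vector set topology" where
  "proj_topology = topology (\<lambda>W. W \<subseteq> proj_line \<and>
     (\<forall>e1 e2. independent {e1, e2} \<and> e1 \<noteq> e2 \<longrightarrow>
        open {z::real \<times> real. z \<noteq> 0 \<and> span {fst z *\<^sub>R e1 + snd z *\<^sub>R e2} \<in> W}))"

lemma openin_proj_topology:
  "openin proj_topology W \<longleftrightarrow> W \<subseteq> (proj_line :: 'a::real_vector set set) \<and>
     (\<forall>e1 e2. independent {e1, e2} \<and> e1 \<noteq> e2 \<longrightarrow>
        open {z::real \<times> real. z \<noteq> 0 \<and> span {fst z *\<^sub>R e1 + snd z *\<^sub>R e2} \<in> W})"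
proof -
  let ?c = "\<lambda>(e1::'a) e2 W. {z::real \<times> real. z \<noteq> 0 \<and> span {fst z *\<^sub>R e1 + snd z *\<^sub>R e2} \<in> W}"
  have Int: "?c e1 e2 (S \<inter> T) = ?c e1 e2 S \<inter> ?c e1 e2 T" for e1 e2 S T by auto
  have Un: "?c e1 e2 (\<Union>\<K>) = (\<Union>S\<in>\<K>. ?c e1 e2 S)" for e1 e2 \<K> by auto
  have "istopology (\<lambda>W. W \<subseteq> (proj_line :: 'a set set) \<and>
     (\<forall>e1 e2. independent {e1, e2} \<and> e1 \<noteq> e2 \<longrightarrow> open (?c e1 e2 W)))"
    unfolding istopology_def Int Un by (auto intro!: open_Int open_UN)
  then show ?thesis
    unfolding proj_topology_def by (simp add: topology_inverse')
qed

lemma topspace_proj_topology: "topspace proj_topology = (proj_line :: 'a::real_vector set set)"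
proof
  show "topspace proj_topology \<subseteq> (proj_line :: 'a set set)"
    using openin_proj_topology[of "topspace proj_topology"] by auto
  have "{z::real \<times> real. z \<noteq> 0 \<and> span {fst z *\<^sub>R e1 + snd z *\<^sub>R e2} \<in> proj_line} = - {0}"
    if e: "independent {e1, e2}" "e1 \<noteq> e2" for e1 e2 :: 'a
  proof -
    have "span {fst z *\<^sub>R e1 + snd z *\<^sub>R e2} \<in> proj_line" if "z \<noteq> 0" for z :: "real \<times> real"
    proof -
      have "fst z *\<^sub>R e1 + snd z *\<^sub>R e2 \<noteq> 0"
      proof
        assume 0: "fst z *\<^sub>R e1 + snd z *\<^sub>R e2 = 0"
        let ?u = "\<lambda>v. if v = e1 then fst z else snd z"
        have "(\<Sum>v\<in>{e1, e2}. ?u v *\<^sub>R v) = 0" using 0 e(2) by auto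
        then have "\<forall>v\<in>{e1, e2}. ?u v = 0"
          using independentD[OF e(1), of "{e1, e2}" ?u] by auto
        then show False using that e(2) by (auto simp: prod_eq_iff split: if_splits)
      qed
      then have "independent {fst z *\<^sub>R e1 + snd z *\<^sub>R e2}" by simp
      then show ?thesis
        unfolding proj_line_def using dim_span_eq_card_independent by fastforce
    qed
    then show ?thesis by auto
  qed
  then have "openin proj_topology (proj_line :: 'a set set)"
    unfolding openin_proj_topology by auto
  then show "(proj_line :: 'a set set) \<subseteq> topspace proj_topology"
    by (rule openin_subset)
qed

definition cr_dom :: "('a::real_vector set \<times> 'a set \<times> 'a set \<times> 'a set) set" where
  "cr_dom = {(p1, p2, p3, p4).
     {p1, p2, p3, p4} \<subseteq> proj_line \<and>
     \<not> (p1 = p2 \<and> p2 = p3) \<and> \<not> (p1 = p2 \<and> p2 = p4) \<and>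
     \<not> (p1 = p3 \<and> p3 = p4) \<and> \<not> (p2 = p3 \<and> p3 = p4)}"

text \<open>
  The one-point compactification of the reals is taken on \<open>real option\<close>, with \<open>None\<close> as the
  point at infinity.
\<close>

definition cross_ratio :: "'a::real_vector set \<times> 'a set \<times> 'a set \<times> 'a set \<Rightarrow> real option" where
  "cross_ratio = (THE c. c \<in> extensional cr_dom \<and>
     continuous_map
       (subtopology (prod_topology proj_topology (prod_topology proj_topology
          (prod_topology proj_topology proj_topology))) cr_dom)
       (Alexandroff_compactification euclideanreal) c \<and>
     (\<forall>x e1 e2. independent {e1, e2} \<and> e1 \<noteq> e2 \<longrightarrow>
        c (span {e1 + x *\<^sub>R e2}, span {e1 + e2}, span {e1}, span {e2}) = Some x))"

definition C_zero :: "('a::real_vector set \<times> 'a set \<times> 'a set \<times> 'a set) set" where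
  "C_zero = {z \<in> cr_dom. cross_ratio z \<noteq> Some 0}"

definition C_infinity :: "('a::real_vector set \<times> 'a set \<times> 'a set \<times> 'a set) set" where
  "C_infinity = {z \<in> cr_dom. cross_ratio z \<noteq> None}"

text \<open>
  The two closed arcs with given distinct extremities are the images of the segments
  \<open>[v, w]\<close> and \<open>[v, - w]\<close>, where \<open>v\<close> and \<open>w\<close> span the extremities.
\<close>

definition closed_arc :: "'a::real_vector set \<Rightarrow> 'a set \<Rightarrow> 'a set set \<Rightarrow> bool" where
  "closed_arc p q A \<longleftrightarrow> (\<exists>v w. independent {v, w} \<and> v \<noteq> w \<and> p = span {v} \<and> q = span {w} \<and>
     A = (\<lambda>x. span {x}) ` closed_segment v w)"

definition arc_seg ::
    "('a::real_vector set \<times> 'a set \<Rightarrow> 'a set) \<Rightarrow> 'a set \<Rightarrow> 'a set \<Rightarrow> 'a set set" where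
  "arc_seg B p q = (THE A. closed_arc p q A \<and> B (p, q) \<in> proj_topology interior_of A)"

definition r_quad ::
    "('a::real_vector set \<times> 'a set \<Rightarrow> 'a set) \<Rightarrow> 'a set \<Rightarrow> 'a set \<Rightarrow> 'a set \<Rightarrow> 'a set
      \<Rightarrow> 'a set \<times> 'a set \<times> 'a set \<times> 'a set" where
  "r_quad B q a b c = (B (a, c), B (b, c), B (a, b), q)"

definition r_fun ::
    "('a::real_vector set \<times> 'a set \<Rightarrow> 'a set) \<Rightarrow> 'a set \<Rightarrow> 'a set \<Rightarrow> 'a set \<Rightarrow> 'a set
      \<Rightarrow> real option" where
  "r_fun B q a b c = cross_ratio (r_quad B q a b c)"

text \<open>Only meaningful when both values of \<open>r_fun\<close> are finite.\<close>

definition d_fun ::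
    "('a::real_vector set \<times> 'a set \<Rightarrow> 'a set) \<Rightarrow> 'a set \<Rightarrow> 'a set \<Rightarrow> 'a set \<Rightarrow> 'a set \<Rightarrow> 'a set
      \<Rightarrow> real" where
  "d_fun B q x y u v = the (r_fun B q u x v) - the (r_fun B q u y v)"

definition eps ::
    "'a::real_vector set set \<Rightarrow> 'a set \<Rightarrow> 'a set \<Rightarrow> 'a set \<Rightarrow> 'a set \<Rightarrow> real" where
  "eps U p q r s = (THE e. \<forall>k \<in> proj_line - U.
     e = sgn (the (cross_ratio (p, r, s, k)) - the (cross_ratio (q, r, s, k))))"

definition sigma_map :: "'a::real_vector set \<Rightarrow> 'a \<Rightarrow> 'a set \<Rightarrow> 'a" where
  "sigma_map L e M = (THE w. w \<in> M \<and> w - e \<in> L)"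

text \<open>
  The equality \<open>b = \<epsilon>\<^sub>U(x, y; u, v) d\<^sub>q(x, y; u, v) \<sigma>\<^sub>q\<^sup>e(B(x, y))\<close>, together with
  the requirement that the two cross-ratios occurring in \<open>d\<^sub>q\<close> are defined and finite.
\<close>

definition star_eq ::
    "('a::real_vector set \<times> 'a set \<Rightarrow> 'a set) \<Rightarrow> 'a set set \<Rightarrow> 'a set
      \<Rightarrow> 'a set \<Rightarrow> 'a set \<Rightarrow> 'a set \<Rightarrow> 'a set \<Rightarrow> 'a \<Rightarrow> 'a \<Rightarrow> bool" where
  "star_eq B U q x y u v b e \<longleftrightarrow>
     r_quad B q u x v \<in> C_infinity \<and> r_quad B q u y v \<in> C_infinity \<and>
     b = (eps U x y u v * d_fun B q x y u v) *\<^sub>R sigma_map q e (B (x, y))"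

definition bounded_borel :: "'a::real_vector set set \<Rightarrow> 'a set set set" where
  "bounded_borel U = {A \<in> sigma_sets U {W. openin proj_topology W \<and> W \<subseteq> U}.
     \<exists>K. compactin proj_topology K \<and> A \<subseteq> K \<and> K \<subseteq> U}"

text \<open>
  Vector-valued Radon measures on \<open>U\<close>, as countably additive functions on the relatively compact
  Borel subsets of \<open>U\<close>; the total mass may be infinite. As \<open>E\<close> is finite-dimensional,
  convergence of the series in \<open>E\<close> is convergence under every linear form.
\<close>

definition vector_measure :: "'a::real_vector set set \<Rightarrow> ('a set set \<Rightarrow> 'a) \<Rightarrow> bool" where
  "vector_measure U \<beta> \<longleftrightarrow>
     (\<forall>A :: nat \<Rightarrow> 'a set set. range A \<subseteq> bounded_borel U \<and> disjoint_family A \<and>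
        (\<Union>n. A n) \<in> bounded_borel U \<longrightarrow>
        (\<forall>f :: 'a \<Rightarrow> real. linear f \<longrightarrow> (\<lambda>n. f (\<beta> (A n))) sums f (\<beta> (\<Union>n. A n))))"

definition bary_map ::
    "('a::real_vector set \<Rightarrow> 'a set \<Rightarrow> 'a set set) \<Rightarrow> ('a set set \<Rightarrow> 'a)
      \<Rightarrow> 'a set \<times> 'a set \<Rightarrow> 'a set" where
  "bary_map seg \<beta> = (\<lambda>(x, y). if x = y then x else span {\<beta> (seg x y)})"

end

(*
  In an affine chart of the projective line whose point at infinity lies outside U, the set U is an
  open interval I and H5 forces B to be a continuous strictly internal mean b on I.  Condition H6 says
  that the opposite pairs among the six values of b on four points are in involution.  This makes b
  strictly increasing in each variable, and then the ratios of masses read off from b by splitting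
  intervals are consistent: there are functions W, M on I with W increasing and
  (W y - W x) * b x y = M y - M x.  Since b x x = x, the function M, expressed in terms of s = W x, is
  a primitive of the inverse G of W.  Hence the measure on U with density s |-> (1, G s) with respect
  to the parameter s has (W y - W x, M y - M x) as its value on the arc from x to y.  A linear form
  with kernel q turns the cross-ratios in the equality to be proved into quotients of increments.
*)
theory Submission
  imports Defs
begin

section \<open>Means on an interval in involution\<close>

text \<open>H6 speaks only of quadruples whose two cross-ratios are finite and nonzero. In the chart
  this is a list of seven inequalities between values of \<open>b\<close>, and strict monotonicity,
  which would supply most of them, is not among the hypotheses. It has to be extracted from the
  conditional relation itself, at points where betweenness and continuity provide the inequalities;
  only then does the relation hold for all distinct points. The formula for \<open>W\<close> solves
  a linear system: for mass 1 on the interval from \<open>u\<close> to \<open>v\<close>, the masses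
  of the two parts cut off at \<open>x\<close> add up to 1, and their barycenters
  \<open>b u x\<close>, \<open>b x v\<close> have weighted mean \<open>b u v\<close>. That the
  solutions for two cutting points \<open>x\<close>, \<open>y\<close> fit the barycenter
  \<open>b x y\<close> is exactly the involution relation for \<open>u\<close>, \<open>v\<close>,
  \<open>x\<close>, \<open>y\<close>. Arcs carry no orientation, increments do. The sign
  \<open>eps\<close> compensates this, so that the computation can use antisymmetric increments,
  which are additive in every order of the points.\<close>

text \<open>
  The last assumption, which is H6 in an affine coordinate, says that the pairs
  \<open>(b p q, b r s)\<close>, \<open>(b p r, b q s)\<close>, \<open>(b p s, b q r)\<close> are in involution. This relation is
  symmetric in \<open>p\<close>, \<open>q\<close>, \<open>r\<close>, \<open>s\<close>, but it is only assumed away from degenerate positions.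
\<close>

locale involutive_mean =
  fixes I :: "real set" and b :: "real \<Rightarrow> real \<Rightarrow> real"
  assumes open_I: "open I" and conn_I: "connected I"
    and cont_b: "continuous_on (I \<times> I) (\<lambda>(x, y). b x y)"
    and b_comm: "\<And>x y. x \<in> I \<Longrightarrow> y \<in> I \<Longrightarrow> b x y = b y x"
    and b_between: "\<And>x y. x \<in> I \<Longrightarrow> y \<in> I \<Longrightarrow> x < y \<Longrightarrow> x < b x y \<and> b x y < y"
    and b_involution: "\<And>p q r s. p \<in> I \<Longrightarrow> q \<in> I \<Longrightarrow> r \<in> I \<Longrightarrow> s \<in> I \<Longrightarrow>
      b p q \<noteq> b p s \<Longrightarrow> b p r \<noteq> b r s \<Longrightarrow> b p q \<noteq> b r s \<Longrightarrow> b p r \<noteq> b p s \<Longrightarrow>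
      b p q \<noteq> b q s \<Longrightarrow> b q r \<noteq> b r s \<Longrightarrow> b q r \<noteq> b q s \<Longrightarrow>
      (b p q - b p s) * (b p r - b r s) * (b q r - b q s) =
      (b p q - b q s) * (b q r - b r s) * (b p r - b p s)"
begin

lemma I_interval: "x \<in> I \<Longrightarrow> y \<in> I \<Longrightarrow> {x..y} \<subseteq> I"
  using conn_I by (meson atLeastAtMost_iff connected_iff_interval subsetI)

lemma continuous_on_b [continuous_intros]:
  assumes "continuous_on S f" "continuous_on S g" "f ` S \<subseteq> I" "g ` S \<subseteq> I"
  shows "continuous_on S (\<lambda>x. b (f x) (g x))"
proof -
  have "continuous_on S ((\<lambda>(x, y). b x y) \<circ> (\<lambda>x. (f x, g x)))"
    by (intro continuous_on_compose continuous_intros assms continuous_on_subset[OF cont_b])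
      (use assms in auto)
  then show ?thesis by (simp add: o_def)
qed

lemma tendsto_b:
  assumes "x \<in> I" "y \<in> I" shows "((\<lambda>t. b t y) \<longlongrightarrow> b x y) (at x)" "((\<lambda>t. b x t) \<longlongrightarrow> b x y) (at y)"
proof -
  have "continuous_on I (\<lambda>t. b t y)" "continuous_on I (\<lambda>t. b x t)"
    using assms by (intro continuous_intros; auto)+
  then show "((\<lambda>t. b t y) \<longlongrightarrow> b x y) (at x)" "((\<lambda>t. b x t) \<longlongrightarrow> b x y) (at y)"
    using assms open_I by (auto simp: continuous_on_eq_continuous_at isCont_def)
qed

text \<open>Betweenness says nothing on the diagonal; continuity squeezes \<open>b x t\<close>
  between \<open>x\<close> and \<open>t\<close> as \<open>t\<close> decreases to
  \<open>x\<close>.\<close>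

lemma b_diag: assumes "x \<in> I" shows "b x x = x"
proof -
  have lim: "((\<lambda>t. b x t) \<longlongrightarrow> b x x) (at_right x)"
    using tendsto_b(2)[OF assms assms] by (rule filterlim_mono) (auto simp: at_le)
  have ev: "\<forall>\<^sub>F t in at_right x. t \<in> I \<and> x < t"
    using open_I assms
    by (intro eventually_conj) (auto simp: eventually_at_right_less eventually_at_topological)
  have "((\<lambda>t. b x t) \<longlongrightarrow> x) (at_right x)"
  proof (rule tendsto_sandwich)
    show "\<forall>\<^sub>F t in at_right x. x \<le> b x t" "\<forall>\<^sub>F t in at_right x. b x t \<le> t"
      using ev b_between[OF assms] by (auto elim!: eventually_mono intro: less_imp_le)
    show "((\<lambda>t. x) \<longlongrightarrow> x) (at_right x)" "((\<lambda>t. t) \<longlongrightarrow> x) (at_right x)"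
      by auto
  qed
  then show ?thesis using lim tendsto_unique trivial_limit_at_right_real by blast
qed

text \<open>
  At the last zero \<open>p\<close> of \<open>q \<mapsto> b q s - b q r\<close> before \<open>r\<close>, the involution
  condition for \<open>p'\<close>, \<open>q\<close> with \<open>p' \<down> p\<close> forces a zero at every nearby \<open>q > p\<close>.
\<close>

lemma b_strict_mono_right_of:
  assumes I: "q0 \<in> I" "r \<in> I" "s \<in> I" and qr: "q0 < r" and rs: "r < s"
  shows "b q0 r < b q0 s"
proof (rule ccontr)
  assume neg: "\<not> b q0 r < b q0 s"
  define g where "g q = b q s - b q r" for q
  have sub: "{q0..r} \<subseteq> I" using I_interval I by auto
  have contg: "continuous_on {q0..r} g"
    unfolding g_def using sub I by (intro continuous_intros) auto
  have gr: "g r > 0" using b_between[of r s] b_diag[of r] I rs by (simp add: g_def)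
  have "\<exists>q\<ge>q0. q \<le> r \<and> g q = 0"
    using neg gr qr contg by (intro IVT') (auto simp: g_def)
  moreover define Z where "Z = {q \<in> {q0..r}. g q = 0}"
  ultimately have Zne: "Z \<noteq> {}" by auto
  have "closed Z"
    unfolding Z_def by (rule continuous_closed_preimage_constant[OF contg closed_atLeastAtMost])
  then have "compact ({q0..r} \<inter> Z)"
    by (intro compact_Int_closed) auto
  moreover have "{q0..r} \<inter> Z = Z"
    by (auto simp: Z_def)
  ultimately have "compact Z" by argo
  then obtain p where p: "p \<in> Z" "\<And>q. q \<in> Z \<Longrightarrow> q \<le> p"
    using compact_attains_sup[OF _ Zne] by blast
  have pr: "p < r" using p(1) gr by (cases "p = r") (auto simp: Z_def)
  have pI: "p \<in> I" and p0: "q0 \<le> p" and gp: "g p = 0" using p(1) sub by (auto simp: Z_def)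
  have nz: "g q \<noteq> 0" if "p < q" "q \<le> r" for q
    using p(2)[of q] that p0 by (auto simp: Z_def)
  have ps: "p < b p s" using b_between[of p s] pI I pr rs by auto
  \<comment> \<open>The bound by \<open>b p s\<close> gives \<open>b p q < q < b p s\<close>, and
    \<open>q < b t s\<close> persists for \<open>t\<close> near \<open>p\<close>.\<close>
  define q where "q = (p + min r (b p s)) / 2"
  have q: "p < q" "q < r" "q < b p s" using pr ps by (auto simp: q_def min_def)
  have qI: "q \<in> I" using q p0 sub by auto
  have bpq: "b p q < q" using b_between[of p q] pI qI q by auto
  have bqr: "b q r < r" "q < b q r" using b_between[of q r] I qI q by auto
  have brs: "r < b r s" using b_between[of r s] I rs by auto
  have bpr: "b p r < r" using b_between[of p r] pI I pr by auto
  have bqs: "q < b q s" using b_between[of q s] qI I q rs by auto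
  have ev1: "\<forall>\<^sub>F t in at_right p. p < t \<and> t < q"
    using q(1) by (simp add: eventually_at_right_less eventually_at_right_field) (use q(1) in blast)
  have lim: "((\<lambda>t. b t y) \<longlongrightarrow> b p y) (at_right p)" if "y \<in> I" for y
    using tendsto_b(1)[OF pI that] by (rule filterlim_mono) (auto simp: at_le)
  have "\<forall>\<^sub>F t in at_right p. q < b t s"
    using order_tendstoD(1)[OF lim[of s]] I q by auto
  \<comment> \<open>\<open>q < b t s\<close> separates \<open>b t q\<close> from
    \<open>b t s\<close>; the other six inequalities come from betweenness and from \<open>g\<close>
    having no zero after \<open>p\<close>.\<close>
  then have "\<forall>\<^sub>F t in at_right p. (b t q - b t s) * (b t r - b r s) * g q =
      (b t q - b q s) * (b q r - b r s) * g t"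
    using ev1
  proof eventually_elim
    case (elim t)
    have tI: "t \<in> I" using elim p0 q sub by auto
    have "b t q < q" using b_between[of t q] tI qI elim by auto
    moreover have "b t r < r" using b_between[of t r] tI I elim q by auto
    ultimately have "(b t q - b t s) * (b t r - b r s) * (b q r - b q s) =
      (b t q - b q s) * (b q r - b r s) * (b t r - b t s)"
      using nz[of t] nz[of q] elim q bqr brs bqs tI qI I
      by (intro b_involution) (auto simp: g_def)
    then show ?case by (simp add: g_def algebra_simps)
  qed
  moreover have "((\<lambda>t. (b t q - b t s) * (b t r - b r s) * g q) \<longlongrightarrow>
      (b p q - b p s) * (b p r - b r s) * g q) (at_right p)"
    by (intro tendsto_intros lim qI I)
  ultimately have "((\<lambda>t. (b t q - b q s) * (b q r - b r s) * g t) \<longlongrightarrow>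
      (b p q - b p s) * (b p r - b r s) * g q) (at_right p)"
    by (rule Lim_transform_eventually[rotated])
  moreover have "((\<lambda>t. (b t q - b q s) * (b q r - b r s) * g t) \<longlongrightarrow>
      (b p q - b q s) * (b q r - b r s) * g p) (at_right p)"
    unfolding g_def by (intro tendsto_intros lim qI I)
  \<comment> \<open>At \<open>t = p\<close> the relation is not assumed, since
    \<open>b p r = b p s\<close>. It holds there as a limit: the right side vanishes with
    \<open>g p\<close>, but no factor on the left does.\<close>
  ultimately have "(b p q - b p s) * (b p r - b r s) * g q = (b p q - b q s) * (b q r - b r s) * g p"
    using tendsto_unique trivial_limit_at_right_real by blast
  then show False using gp nz[of q] q bpq bpr brs by auto
qed

end

text \<open>Each side of the involution relation is a product of three differences, so negation
  changes the sign of both. The reflection carries \<open>b_strict_mono_right_of\<close>, where the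
  fixed argument lies to the left of the other two, to the case where it lies to the right.\<close>

lemma (in involutive_mean) reflect: "involutive_mean (uminus ` I) (\<lambda>x y. - b (- x) (- y))"
proof
  show "open (uminus ` I)" by (simp add: open_I open_negations)
  show "connected (uminus ` I)"
    by (intro connected_continuous_image conn_I continuous_intros)
  show "continuous_on (uminus ` I \<times> uminus ` I) (\<lambda>(x, y). - b (- x) (- y))"
    unfolding case_prod_unfold
    by (intro continuous_intros) auto
  show "- b (- x) (- y) = - b (- y) (- x)" if "x \<in> uminus ` I" "y \<in> uminus ` I" for x y
    using that b_comm by auto
  show "x < - b (- x) (- y) \<and> - b (- x) (- y) < y"
    if "x \<in> uminus ` I" "y \<in> uminus ` I" "x < y" for x y
    using that b_between[of "- y" "- x"] b_comm[of "- x" "- y"] by auto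
  show "(- b (- p) (- q) - - b (- p) (- s)) * (- b (- p) (- r) - - b (- r) (- s)) * (- b (- q) (- r) - - b (- q) (- s)) =
      (- b (- p) (- q) - - b (- q) (- s)) * (- b (- q) (- r) - - b (- r) (- s)) * (- b (- p) (- r) - - b (- p) (- s))"
    if "p \<in> uminus ` I" "q \<in> uminus ` I" "r \<in> uminus ` I" "s \<in> uminus ` I"
      "- b (- p) (- q) \<noteq> - b (- p) (- s)" "- b (- p) (- r) \<noteq> - b (- r) (- s)"
      "- b (- p) (- q) \<noteq> - b (- r) (- s)" "- b (- p) (- r) \<noteq> - b (- p) (- s)"
      "- b (- p) (- q) \<noteq> - b (- q) (- s)" "- b (- q) (- r) \<noteq> - b (- r) (- s)"
      "- b (- q) (- r) \<noteq> - b (- q) (- s)" for p q r s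
    using b_involution[of "-p" "-q" "-r" "-s"] that by (auto simp: algebra_simps)
qed

section \<open>Monotonicity in each variable and the involution in all positions\<close>

context involutive_mean
begin

text \<open>If \<open>x\<close> lies between \<open>y\<close> and \<open>z\<close>, betweenness
  already puts \<open>b x y\<close> and \<open>b x z\<close> on different sides of \<open>x\<close>.
  Only the positions outside need the involution.\<close>

lemma b_strict_mono:
  assumes "x \<in> I" "y \<in> I" "z \<in> I" "y < z" shows "b x y < b x z"
proof -
  interpret R: involutive_mean "uminus ` I" "\<lambda>x y. - b (- x) (- y)" by (rule reflect)
  consider "x < y" | "x = y" | "y < x" "x < z" | "x = z" | "z < x" using assms(4) by linarith
  then show ?thesis
  proof cases
    case 1 then show ?thesis using b_strict_mono_right_of[of x y z] assms by auto
  next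
    case 2 then show ?thesis using b_diag b_between[of x z] assms by auto
  next
    case 3 then show ?thesis
      using b_between[of y x] b_between[of x z] b_comm[of x y] assms by auto
  next
    case 4 then show ?thesis using b_diag b_between[of y z] b_comm[of y z] assms by auto
  next
    case 5 then show ?thesis using R.b_strict_mono_right_of[of "-x" "-z" "-y"] assms by auto
  qed
qed

lemma b_less_iff:
  assumes "x \<in> I" "y \<in> I" "z \<in> I" shows "b x y < b x z \<longleftrightarrow> y < z"
  using b_strict_mono[of x y z] b_strict_mono[of x z y] assms by (cases y z rule: linorder_cases) auto

lemma b_less_iff_left:
  assumes "x \<in> I" "y \<in> I" "z \<in> I" shows "b y x < b z x \<longleftrightarrow> y < z"
  unfolding b_comm[OF assms(2,1)] b_comm[OF assms(3,1)] by (rule b_less_iff[OF assms])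

text \<open>Betweenness gives \<open>b p q < b r s\<close>, and monotonicity gives the other six
  inequalities that the relation requires.\<close>

lemma involution_sorted:
  assumes I: "p \<in> I" "q \<in> I" "r \<in> I" "s \<in> I" and "p < q" "q < r" "r < s"
  shows "(b p q - b p s) * (b p r - b r s) * (b q r - b q s) =
         (b p q - b q s) * (b q r - b r s) * (b p r - b p s)"
proof -
  have "b p q < q" "r < b r s" using b_between I assms by auto
  moreover have "b p q < b p s" "b p r < b p s" "b q r < b q s" "b p r < b r s"
    "b p q < b q s" "b q r < b r s"
    using I assms b_less_iff b_less_iff_left b_comm
    by (metis order.strict_trans)+
  ultimately show ?thesis using I assms by (intro b_involution) auto
qed

text \<open>The relation is invariant under permutations of the four points, so each of the six
  positions of \<open>x < y\<close> relative to \<open>u < v\<close> is the sorted case relabelled.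
  Exchanging \<open>x\<close> and \<open>y\<close> exchanges the two sides.\<close>

lemma involution:
  assumes I: "u \<in> I" "v \<in> I" "x \<in> I" "y \<in> I" and "u < v"
    and ne: "x \<noteq> y" "x \<noteq> u" "x \<noteq> v" "y \<noteq> u" "y \<noteq> v"
  shows "(b u v - b u x) * (b x v - b x y) * (b y v - b u y) =
         (b u v - b u y) * (b y v - b x y) * (b x v - b u x)"
proof -
  have *: "(b u v - b u x) * (b x v - b x y) * (b y v - b u y) =
         (b u v - b u y) * (b y v - b x y) * (b x v - b u x)"
    if less: "x < y" "x \<noteq> u" "x \<noteq> v" "y \<noteq> u" "y \<noteq> v" and I: "x \<in> I" "y \<in> I" for x y
  proof -
    note c = b_comm[OF assms(1) \<open>x \<in> I\<close>] b_comm[OF assms(1) \<open>y \<in> I\<close>]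
      b_comm[OF assms(2) \<open>x \<in> I\<close>] b_comm[OF assms(2) \<open>y \<in> I\<close>] b_comm[OF assms(1,2)] b_comm[OF I]
    consider "x < y" "y < u" | "x < u" "u < y" "y < v" | "x < u" "v < y" | "u < x" "y < v"
      | "u < x" "x < v" "v < y" | "v < x"
      using less \<open>u < v\<close> by (smt (verit))
    then show ?thesis
    proof cases
      case 1
      then show ?thesis
        using involution_sorted[of x y u v] assms(1-5) I less(1) unfolding c by (simp add: algebra_simps)
    next
      case 2
      then show ?thesis
        using involution_sorted[of x u y v] assms(1-5) I less(1) unfolding c by (simp add: algebra_simps)
    next
      case 3
      then show ?thesis
        using involution_sorted[of x u v y] assms(1-5) I less(1) unfolding c by (simp add: algebra_simps)
    next
      case 4
      then show ?thesis
        using involution_sorted[of u x y v] assms(1-5) I less(1) unfolding c by (simp add: algebra_simps)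
    next
      case 5
      then show ?thesis
        using involution_sorted[of u x v y] assms(1-5) I less(1) unfolding c by (simp add: algebra_simps)
    next
      case 6
      then show ?thesis
        using involution_sorted[of u v x y] assms(1-5) I less(1) unfolding c by (simp add: algebra_simps)
    qed
  qed
  show ?thesis
  proof (cases "x < y")
    case True then show ?thesis using * assms by blast
  next
    case False then show ?thesis using *[of y x] assms b_comm[of x y] by auto
  qed
qed

text \<open>
  If \<open>b x y\<close> is the barycenter of a positive measure on \<open>[x, y]\<close>, then splitting
  \<open>[u, v]\<close> at \<open>x\<close> determines the mass of \<open>[x, v]\<close> relative to \<open>[u, v]\<close>; this is \<open>- W x\<close>.
\<close>

lemma exists_primitive:
  assumes uv: "u \<in> I" "v \<in> I" "u < v"
  obtains W M :: "real \<Rightarrow> real" where "strict_mono_on I W" "continuous_on I W"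
    "\<And>x y. x \<in> I \<Longrightarrow> y \<in> I \<Longrightarrow> (W y - W x) * b x y = M y - M x"
proof -
  define W where "W x = - (b u v - b u x) / (b x v - b u x)" for x
  \<comment> \<open>The first moment that goes with the mass \<open>W x\<close>: both are minus the
    value on the oriented interval from \<open>x\<close> to \<open>v\<close>, hence zero at
    \<open>v\<close>.\<close>
  define M where "M x = W x * b x v" for x
  have den: "b x v - b u x > 0" if "x \<in> I" for x
    using b_less_iff[of x u v] b_comm[of u x] that uv by auto
  have Wv: "W v = 0" and Wu: "W u = -1"
    using uv den[of u] by (auto simp: W_def divide_simps)
  have W1: "W x * (b x v - b u x) = b u x - b u v" if "x \<in> I" for x
    using den[OF that] by (simp add: W_def)
  have pos: "W x > 0" if "x \<in> I" "v < x" for x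
    using den[of x] b_less_iff[of u v x] that uv by (auto simp: W_def divide_simps)
  have neg: "W x < 0" if "x \<in> I" "x < v" for x
    using den[of x] b_less_iff[of u x v] that uv by (auto simp: W_def divide_simps)
  \<comment> \<open>Pairs containing \<open>v\<close> satisfy this by the choice of
    \<open>M\<close>, pairs containing \<open>u\<close> by the choice of \<open>W\<close>. For all
    other pairs, multiplication by the two denominators turns it into the involution
    relation.\<close>
  have eq: "(W y - W x) * b x y = M y - M x" if I: "x \<in> I" "y \<in> I" for x y
  proof -
    consider "x = y" | "x = v" | "y = v" | "x \<noteq> v" "y \<noteq> v" "x \<noteq> y" "x = u"
      | "x \<noteq> v" "y \<noteq> v" "x \<noteq> y" "y = u" | "x \<noteq> y" "x \<noteq> u" "x \<noteq> v" "y \<noteq> u" "y \<noteq> v" by blast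
    then show ?thesis
    proof cases
      case 1 then show ?thesis by simp
    next
      case 2 then show ?thesis using b_comm[of x y] I by (simp add: M_def Wv)
    next
      case 3 then show ?thesis using b_comm[of x y] I by (simp add: M_def Wv)
    next
      case 4 then show ?thesis using W1[of y] I Wu by (simp add: M_def algebra_simps)
    next
      case 5 then show ?thesis using W1[of x] I Wu b_comm[of x y]
        by (simp add: M_def algebra_simps)
    next
      case 6
      have "(b x v - b u x) * (b y v - b u y) * (W x * (b x v - b x y) - W y * (b y v - b x y))
          = (W x * (b x v - b u x)) * (b y v - b u y) * (b x v - b x y)
          - (W y * (b y v - b u y)) * (b x v - b u x) * (b y v - b x y)"
        by (simp add: algebra_simps)
      also have "\<dots> = 0"
        using involution[of u v x y] 6 uv I unfolding W1[OF I(1)] W1[OF I(2)]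
        by (simp add: algebra_simps)
      finally have "W x * (b x v - b x y) - W y * (b y v - b x y) = 0"
        using den[OF I(1)] den[OF I(2)] by (metis mult_eq_0_iff order_less_irrefl)
      then show ?thesis by (simp add: M_def algebra_simps)
    qed
  qed
  have mono: "W x < W y" if I: "x \<in> I" "y \<in> I" "x < y" for x y
  proof (cases "y = v")
    case True then show ?thesis using neg[of x] that Wv by auto
  next
    case False
    \<comment> \<open>Eliminating \<open>M\<close> isolates \<open>W y - W x\<close>: the factor
      \<open>b x v - b x y\<close> and \<open>W y\<close> have opposite signs, and
      \<open>b x v - b y v\<close> is negative.\<close>
    have "(W y - W x) * (b x v - b x y) = W y * (b x v - b y v)"
      using eq[OF I(1,2)] by (simp add: M_def algebra_simps)
    moreover have "b x v < b y v" using b_less_iff_left that uv by auto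
    moreover have "(y < v \<and> b x v > b x y \<and> W y < 0) \<or> (v < y \<and> b x v < b x y \<and> W y > 0)"
      using b_less_iff[of x] pos neg False that uv by (meson linorder_less_linear)
    ultimately show ?thesis
      by (metis diff_gt_0_iff_gt diff_less_0_iff_less mult_neg_neg mult_pos_neg
          mult_less_0_iff order_less_asym zero_less_mult_iff)
  qed
  have "continuous_on I W"
    unfolding W_def using uv den by (intro continuous_intros) (auto, fastforce)
  then show ?thesis using that[of W M] mono eq by (auto simp: strict_mono_on_def)
qed

end

section \<open>The mass \<open>W\<close> as a parameter\<close>

context involutive_mean
begin

context
  fixes W M :: "real \<Rightarrow> real"
  assumes W_mono: "strict_mono_on I W" and W_cont: "continuous_on I W"
    and WM: "\<And>x y. x \<in> I \<Longrightarrow> y \<in> I \<Longrightarrow> (W y - W x) * b x y = M y - M x"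
begin

lemma W_less_iff: "x \<in> I \<Longrightarrow> y \<in> I \<Longrightarrow> W x < W y \<longleftrightarrow> x < y"
  using W_mono by (simp add: strict_mono_on_less)

lemma W_inj: "inj_on W I"
  using W_mono by (rule strict_mono_on_imp_inj_on)

lemma open_W_image: "open (W ` I)"
  using W_cont open_I W_inj by (rule invariance_of_domain)

lemma inv_W_cont: "continuous_on (W ` I) (inv_into I W)"
  using W_cont open_I W_inj by (intro continuous_on_inverse_open) auto

lemma inv_W_in: "s \<in> W ` I \<Longrightarrow> inv_into I W s \<in> I"
  by (rule inv_into_into)

lemma W_Icc_image:
  assumes "x \<in> I" "y \<in> I" "x \<le> y" shows "W ` {x..y} = {W x..W y}"
proof
  have sub: "{x..y} \<subseteq> I" using I_interval assms by blast
  show "W ` {x..y} \<subseteq> {W x..W y}"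
    using W_mono sub assms by (auto simp: strict_mono_on_less_eq subset_iff)
  show "{W x..W y} \<subseteq> W ` {x..y}"
  proof
    fix s assume "s \<in> {W x..W y}"
    then show "s \<in> W ` {x..y}"
      using IVT'[of W x s y] continuous_on_subset[OF W_cont sub] assms by auto
  qed
qed

text \<open>The difference quotient of \<open>M\<close> in the parameter \<open>s\<close> is itself
  a value of \<open>b\<close>, namely \<open>b (?G s) (?G t)\<close>, so differentiability needs
  only the continuity of \<open>b\<close> and of the inverse of \<open>W\<close>.\<close>

lemma inv_W_integral:
  assumes I: "x \<in> I" "y \<in> I" and xy: "x \<le> y"
  shows "(LINT s:{W x..W y}|lborel. inv_into I W s) = M y - M x"
proof -
  let ?G = "inv_into I W"
  have sub: "{W x..W y} \<subseteq> W ` I"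
    using W_Icc_image[OF assms] I_interval[OF I] by auto
  have GW: "?G (W t) = t" if "t \<in> I" for t using W_inj that by simp
  have deriv: "((\<lambda>s. M (?G s)) has_real_derivative ?G s) (at s)" if "s \<in> W ` I" for s
  proof -
    have GI: "?G s \<in> I" using inv_W_in that by auto
    have ev: "\<forall>\<^sub>F t in at s. t \<in> W ` I \<and> t \<noteq> s"
      using open_W_image that by (auto simp: eventually_at_topological)
    have "continuous_on (W ` I) (\<lambda>t. b (?G s) (?G t))"
      using GI inv_W_in by (intro continuous_on_b continuous_intros inv_W_cont) auto
    then have "((\<lambda>t. b (?G s) (?G t)) \<longlongrightarrow> b (?G s) (?G s)) (at s)"
      using open_W_image that by (auto simp: continuous_on_eq_continuous_at isCont_def)
    then have "((\<lambda>t. b (?G s) (?G t)) \<longlongrightarrow> ?G s) (at s)"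
      using b_diag[OF GI] by simp
    then have "((\<lambda>t. (M (?G t) - M (?G s)) / (t - s)) \<longlongrightarrow> ?G s) (at s)"
    proof (rule Lim_transform_eventually)
      show "\<forall>\<^sub>F t in at s. b (?G s) (?G t) = (M (?G t) - M (?G s)) / (t - s)"
        using ev
      proof eventually_elim
        case (elim t)
        then have "(t - s) * b (?G s) (?G t) = M (?G t) - M (?G s)"
          using WM[OF GI inv_W_in[of t]] that by (simp add: f_inv_into_f)
        then show ?case using elim by (simp add: field_simps)
      qed
    qed
    then show ?thesis by (simp add: has_field_derivative_iff)
  qed
  have "(\<integral>s. indicator {W x..W y} s *\<^sub>R ?G s \<partial>lborel) = M (?G (W y)) - M (?G (W x))"
  proof (rule integral_FTC_Icc)
    show "W x \<le> W y" using W_mono I xy by (simp add: strict_mono_on_less_eq)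
    show "continuous_on {W x..W y} ?G" using continuous_on_subset[OF inv_W_cont sub] .
    show "((\<lambda>s. M (?G s)) has_vector_derivative ?G s) (at s within {W x..W y})"
      if "W x \<le> s" "s \<le> W y" for s
    proof -
      have "s \<in> W ` I" using that sub by auto
      from deriv[OF this] show ?thesis
        unfolding has_real_derivative_iff_has_vector_derivative
        by (rule has_vector_derivative_at_within)
    qed
  qed
  then show ?thesis using GW I by (simp add: set_lebesgue_integral_def)
qed

end

end

text \<open>The partial sums are integrals over the initial unions, which increase to the whole
  union; integrability there dominates all of them.\<close>

lemma set_integral_sums:
  fixes f :: "_ \<Rightarrow> 'a :: {banach, second_countable_topology}"
  assumes meas: "\<And>i::nat. A i \<in> sets M" and disj: "disjoint_family A"
    and int: "set_integrable M (\<Union>i. A i) f"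
  shows "(\<lambda>i. LINT x:A i|M. f x) sums (LINT x:(\<Union>i. A i)|M. f x)"
proof -
  have intA: "set_integrable M (A i) f" for i
    by (rule set_integrable_subset[OF int meas]) auto
  have fin: "(LINT x:(\<Union>i<n. A i)|M. f x) = (\<Sum>i<n. LINT x:A i|M. f x)" for n
  proof (induction n)
    case (Suc n)
    have "(\<Union>i<n. A i) \<inter> A n = {}"
      using disj by (auto simp: disjoint_family_on_def) (metis disjoint_iff less_irrefl)
    moreover have "set_integrable M (\<Union>i<n. A i) f"
      using meas by (intro set_integrable_subset[OF int]) auto
    ultimately have "(LINT x:(\<Union>i<n. A i) \<union> A n|M. f x) =
        (LINT x:(\<Union>i<n. A i)|M. f x) + (LINT x:A n|M. f x)"
      using intA by (intro set_integral_Un)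
    then show ?case using Suc by (simp add: lessThan_Suc Un_commute)
  qed (simp add: set_lebesgue_integral_def)
  have "(\<lambda>n. LINT x:(\<Union>i<n. A i)|M. f x) \<longlonglongrightarrow> (LINT x:(\<Union>n. \<Union>i<n. A i)|M. f x)"
  proof (rule set_integral_cont_up)
    show "incseq (\<lambda>n. \<Union>i<n. A i)" by (force simp: incseq_def)
    show "set_integrable M (\<Union>n. \<Union>i<n. A i) f"
      using meas by (intro set_integrable_subset[OF int]) auto
  qed (use meas in auto)
  moreover have "(\<Union>n. \<Union>i<n. A i) = (\<Union>i. A i)" by auto
  ultimately show ?thesis by (simp add: sums_def fin)
qed

section \<open>The projective line of a plane\<close>

lemma proj_line_iff: "p \<in> proj_line \<longleftrightarrow> (\<exists>v. v \<noteq> 0 \<and> p = span {v})"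
proof
  assume p: "p \<in> proj_line"
  then obtain S where S: "S \<subseteq> p" "independent S" "p \<subseteq> span S" "card S = dim p"
    using real_vector.basis_exists by blast
  then obtain v where v: "S = {v}" using p by (auto simp: proj_line_def card_1_singleton_iff)
  have "v \<noteq> 0" using S(2) v dependent_zero by auto
  moreover have "p = span {v}"
    using S p v by (intro subset_antisym) (auto simp: proj_line_def span_minimal)
  ultimately show "\<exists>v. v \<noteq> 0 \<and> p = span {v}" by blast
next
  assume "\<exists>v. v \<noteq> 0 \<and> p = span {v}"
  then obtain v where v: "v \<noteq> 0" "p = span {v}" by blast
  then have "dim p = 1" using dim_span_eq_card_independent[of "{v}"] by simp
  then show "p \<in> proj_line" using v by (simp add: proj_line_def)
qed

lemma span_singleton_scale:
  fixes v :: "'a::real_vector" assumes "k \<noteq> 0" shows "span {k *\<^sub>R v} = span {v}"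
proof
  show "span {k *\<^sub>R v} \<subseteq> span {v}"
    by (intro span_minimal) (auto intro: span_scale span_base)
  have "inverse k *\<^sub>R (k *\<^sub>R v) \<in> span {k *\<^sub>R v}"
    by (intro span_scale span_base) auto
  then show "span {v} \<subseteq> span {k *\<^sub>R v}"
    using assms by (intro span_minimal) auto
qed

locale plane_basis =
  fixes e1 e2 :: "'a::real_vector"
  assumes indep: "independent {e1, e2}" and ne: "e1 \<noteq> e2" and span_basis: "span {e1, e2} = UNIV"
begin

definition c1 :: "'a \<Rightarrow> real" where "c1 v = representation {e1, e2} v e1"
definition c2 :: "'a \<Rightarrow> real" where "c2 v = representation {e1, e2} v e2"
text \<open>The determinant in the basis \<open>e1\<close>, \<open>e2\<close>. It vanishes iff
  nonzero vectors span the same line, and for fixed \<open>h \<noteq> 0\<close> the map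
  \<open>v \<mapsto> \<omega> v h\<close> is a linear form with kernel
  \<open>span {h}\<close>.\<close>

definition \<omega> :: "'a \<Rightarrow> 'a \<Rightarrow> real" where "\<omega> v w = c1 v * c2 w - c2 v * c1 w"

lemma c_simps [simp]:
  "c1 e1 = 1" "c1 e2 = 0" "c2 e1 = 0" "c2 e2 = 1"
  "c1 (v + w) = c1 v + c1 w" "c2 (v + w) = c2 v + c2 w"
  "c1 (v - w) = c1 v - c1 w" "c2 (v - w) = c2 v - c2 w"
  "c1 (k *\<^sub>R v) = k * c1 v" "c2 (k *\<^sub>R v) = k * c2 v" "c1 0 = 0" "c2 0 = 0"
  "c1 (- v) = - c1 v" "c2 (- v) = - c2 v"
  using indep ne span_basis
  by (simp_all add: c1_def c2_def representation_basis representation_add representation_scale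
      representation_diff representation_zero representation_neg)

lemma c_expand: "c1 v *\<^sub>R e1 + c2 v *\<^sub>R e2 = v"
  using sum_representation_eq[OF indep, of v "{e1, e2}"] ne span_basis
  by (simp add: c1_def c2_def)

lemma plane_eq_iff: "v = w \<longleftrightarrow> c1 v = c1 w \<and> c2 v = c2 w"
  using c_expand by metis

lemma eq_0_iff: "v = 0 \<longleftrightarrow> c1 v = 0 \<and> c2 v = 0"
  using plane_eq_iff[of v 0] by simp

lemma omega_simps [simp]:
  "\<omega> (v + v') w = \<omega> v w + \<omega> v' w" "\<omega> v (w + w') = \<omega> v w + \<omega> v w'"
  "\<omega> (v - v') w = \<omega> v w - \<omega> v' w" "\<omega> v (w - w') = \<omega> v w - \<omega> v w'"
  "\<omega> (k *\<^sub>R v) w = k * \<omega> v w" "\<omega> v (k *\<^sub>R w) = k * \<omega> v w" "\<omega> v v = 0" "\<omega> 0 w = 0" "\<omega> v 0 = 0"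
  "\<omega> e1 e2 = 1"
  by (simp_all add: \<omega>_def algebra_simps)

lemma omega_swap: "\<omega> v w = - \<omega> w v"
  by (simp add: \<omega>_def)

text \<open>Cramer's rule.\<close>

lemma omega_expand:
  assumes "\<omega> v w \<noteq> 0" shows "z = (\<omega> z w / \<omega> v w) *\<^sub>R v + (\<omega> v z / \<omega> v w) *\<^sub>R w"
  using assms by (simp add: plane_eq_iff divide_simps) (simp add: \<omega>_def algebra_simps)

lemma omega_0_imp_scale:
  assumes "v \<noteq> 0" "\<omega> v w = 0" shows "\<exists>k. w = k *\<^sub>R v"
proof (cases "c1 v = 0")
  case True
  then have "w = (c2 w / c2 v) *\<^sub>R v"
    using assms by (auto simp: eq_0_iff[of v] plane_eq_iff[of w] \<omega>_def)
  then show ?thesis by blast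
next
  case False
  then have "w = (c1 w / c1 v) *\<^sub>R v"
    using assms by (auto simp: plane_eq_iff[of w] \<omega>_def field_simps)
  then show ?thesis by blast
qed

lemma span_eq_iff:
  assumes "v \<noteq> 0" "w \<noteq> 0" shows "span {v} = span {w} \<longleftrightarrow> \<omega> v w = 0"
proof
  assume "span {v} = span {w}"
  then have "w \<in> span {v}" by (simp add: span_base)
  then show "\<omega> v w = 0" by (auto simp: span_singleton)
next
  assume "\<omega> v w = 0"
  then obtain k where k: "w = k *\<^sub>R v" using omega_0_imp_scale assms by blast
  then have "k \<noteq> 0" using assms by auto
  then show "span {v} = span {w}" using span_singleton_scale k by metis
qed

lemma in_span_iff: "v \<noteq> 0 \<Longrightarrow> w \<in> span {v} \<longleftrightarrow> \<omega> v w = 0"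
  using omega_0_imp_scale[of v w] by (auto simp: span_singleton)

lemma independent_iff: "independent {v, w} \<and> v \<noteq> w \<longleftrightarrow> \<omega> v w \<noteq> 0"
proof
  assume *: "independent {v, w} \<and> v \<noteq> w"
  show "\<omega> v w \<noteq> 0"
  proof
    assume 0: "\<omega> v w = 0"
    have "v \<noteq> 0" using * dependent_zero[of "{v, w}"] by auto
    then have "w \<in> span {v}" using 0 in_span_iff by blast
    then show False using * by (auto simp: dependent_def insert_Diff_if insert_commute)
  qed
next
  assume *: "\<omega> v w \<noteq> 0"
  then have "v \<noteq> 0" "v \<noteq> w" by auto
  moreover have "w \<notin> span {v}" using * in_span_iff \<open>v \<noteq> 0\<close> by blast
  ultimately show "independent {v, w} \<and> v \<noteq> w"
    using independent_insert[of w "{v}"] by (simp add: insert_commute)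
qed

definition plane_point :: "real \<times> real \<Rightarrow> 'a" where "plane_point z = fst z *\<^sub>R e1 + snd z *\<^sub>R e2"

lemma c_point [simp]: "c1 (plane_point z) = fst z" "c2 (plane_point z) = snd z"
  by (simp_all add: plane_point_def)

lemma point_c [simp]: "plane_point (c1 v, c2 v) = v"
  by (simp add: plane_point_def c_expand)

lemma point_eq_0 [simp]: "plane_point z = 0 \<longleftrightarrow> z = 0"
  by (simp add: eq_0_iff prod_eq_iff)

lemma proj_line_point: "p \<in> proj_line \<longleftrightarrow> (\<exists>z. z \<noteq> 0 \<and> p = span {plane_point z})"
  unfolding proj_line_iff by (metis point_c point_eq_0)

text \<open>The definition of the topology quantifies over all bases. A change of basis is a
  continuous map \<open>T\<close> of the coordinates, zero only at zero, so the condition for one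
  basis implies the others by preimage.\<close>

lemma openin_proj_iff: "openin proj_topology W \<longleftrightarrow>
    W \<subseteq> proj_line \<and> open {z. z \<noteq> 0 \<and> span {plane_point z} \<in> W}"
proof -
  have "open {z::real \<times> real. z \<noteq> 0 \<and> span {fst z *\<^sub>R f1 + snd z *\<^sub>R f2} \<in> W}"
    if W: "open {z. z \<noteq> 0 \<and> span {plane_point z} \<in> W}" and f: "\<omega> f1 f2 \<noteq> 0" for f1 f2
  proof -
    define T where "T z = (fst z * c1 f1 + snd z * c1 f2, fst z * c2 f1 + snd z * c2 f2)"
      for z :: "real \<times> real"
    have vT: "plane_point (T z) = fst z *\<^sub>R f1 + snd z *\<^sub>R f2" for z
      by (simp add: plane_eq_iff T_def)
    have "T z \<noteq> 0" if "z \<noteq> 0" for z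
    proof
      assume "T z = 0"
      then have *: "fst z *\<^sub>R f1 + snd z *\<^sub>R f2 = 0" using vT point_eq_0 by metis
      have "\<omega> (fst z *\<^sub>R f1 + snd z *\<^sub>R f2) f2 = 0" "\<omega> f1 (fst z *\<^sub>R f1 + snd z *\<^sub>R f2) = 0"
        unfolding * by simp_all
      then show False using f that by (auto simp: prod_eq_iff)
    qed
    moreover have "T 0 = 0" by (simp add: T_def zero_prod_def)
    ultimately have "{z::real \<times> real. z \<noteq> 0 \<and> span {fst z *\<^sub>R f1 + snd z *\<^sub>R f2} \<in> W}
        = T -` {z. z \<noteq> 0 \<and> span {plane_point z} \<in> W}"
      unfolding vT[symmetric] by auto
    moreover have "open \<dots>"
      unfolding T_def by (intro open_vimage W continuous_intros)
    ultimately show ?thesis by simp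
  qed
  then show ?thesis
    unfolding openin_proj_topology independent_iff using omega_simps(10) unfolding plane_point_def
    by (metis (no_types, lifting) zero_neq_one)
qed

text \<open>The projection from the nonzero vectors is an open map: the saturation of a set is the
  union of its nonzero multiples.\<close>

lemma open_proj:
  assumes "open S" shows "openin proj_topology ((\<lambda>z. span {plane_point z}) ` (S - {0}))"
proof -
  have "{z. z \<noteq> 0 \<and> span {plane_point z} \<in> (\<lambda>z. span {plane_point z}) ` (S - {0})} =
      (\<Union>k\<in>-{0}. (*\<^sub>R) k ` (S - {0}))" (is "?l = ?r")
  proof
    show "?l \<subseteq> ?r"
    proof
      fix z assume "z \<in> ?l"
      then obtain y where y: "z \<noteq> 0" "y \<in> S" "y \<noteq> 0" "span {plane_point z} = span {plane_point y}" by auto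
      then have "\<omega> (plane_point y) (plane_point z) = 0" using span_eq_iff[of "plane_point y" "plane_point z"] by simp
      then obtain k where k: "plane_point z = k *\<^sub>R plane_point y" using omega_0_imp_scale[of "plane_point y"] y by auto
      then have "z = k *\<^sub>R y" by (simp add: plane_eq_iff prod_eq_iff)
      then show "z \<in> ?r" using y by auto
    qed
    show "?r \<subseteq> ?l"
    proof
      fix z assume "z \<in> ?r"
      then obtain k y where y: "k \<noteq> 0" "z = k *\<^sub>R y" "y \<in> S" "y \<noteq> 0" by auto
      then have "plane_point z = k *\<^sub>R plane_point y" by (simp add: plane_eq_iff)
      then have "span {plane_point z} = span {plane_point y}" using y by (simp add: span_singleton_scale)
      then show "z \<in> ?l" using y by auto
    qed
  qed
  moreover have "open ?r" using assms by (intro open_UN ballI open_scaling) auto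
  moreover have "(\<lambda>z. span {plane_point z}) ` (S - {0}) \<subseteq> proj_line"
    by (intro image_subsetI) (use proj_line_point in blast)
  ultimately show ?thesis by (simp add: openin_proj_iff)
qed

end

section \<open>The cross-ratio in coordinates\<close>

context plane_basis
begin

definition lift :: "'a set \<Rightarrow> 'a" where "lift p = (SOME v. v \<noteq> 0 \<and> p = span {v})"

lemma lift_span: assumes "v \<noteq> 0" obtains k where "k \<noteq> 0" "lift (span {v}) = k *\<^sub>R v"
proof -
  have *: "lift (span {v}) \<noteq> 0 \<and> span {v} = span {lift (span {v})}"
    unfolding lift_def by (rule someI[of _ v]) (use assms in auto)
  then have "\<omega> v (lift (span {v})) = 0" using span_eq_iff assms by blast
  then obtain k where "lift (span {v}) = k *\<^sub>R v" using omega_0_imp_scale assms by blast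
  then show ?thesis using that * by (metis scaleR_zero_left)
qed

text \<open>Passage from homogeneous coordinates to the compactified line. The pair zero also goes
  to \<open>None\<close>, a default value that \<open>cr_dom_pair_nonzero\<close> keeps away from
  \<open>cr_dom\<close>.\<close>

definition to_ratio :: "real \<times> real \<Rightarrow> real option" where
  "to_ratio z = (if snd z = 0 then None else Some (fst z / snd z))"

definition cr_pair :: "'a \<times> 'a \<times> 'a \<times> 'a \<Rightarrow> real \<times> real" where
  "cr_pair = (\<lambda>(v1, v2, v3, v4). (\<omega> v1 v3 * \<omega> v2 v4, \<omega> v1 v4 * \<omega> v2 v3))"

definition cr_lift :: "'a set \<times> 'a set \<times> 'a set \<times> 'a set \<Rightarrow> real option" where
  "cr_lift = (\<lambda>(p1, p2, p3, p4)\<in>cr_dom. to_ratio (cr_pair (lift p1, lift p2, lift p3, lift p4)))"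

text \<open>Both components of \<open>cr_pair\<close> are linear in each of the four vectors, so the
  choice of spanning vectors cancels in the ratio.\<close>

lemma cr_lift_span:
  assumes "v1 \<noteq> 0" "v2 \<noteq> 0" "v3 \<noteq> 0" "v4 \<noteq> 0"
    and "(span {v1}, span {v2}, span {v3}, span {v4}) \<in> cr_dom"
  shows "cr_lift (span {v1}, span {v2}, span {v3}, span {v4}) = to_ratio (cr_pair (v1, v2, v3, v4))"
proof -
  obtain k1 k2 k3 k4 where k: "k1 \<noteq> 0" "k2 \<noteq> 0" "k3 \<noteq> 0" "k4 \<noteq> 0"
    "lift (span {v1}) = k1 *\<^sub>R v1" "lift (span {v2}) = k2 *\<^sub>R v2"
    "lift (span {v3}) = k3 *\<^sub>R v3" "lift (span {v4}) = k4 *\<^sub>R v4"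
    using assms lift_span by metis
  then show ?thesis
    using assms(5) by (simp add: cr_lift_def cr_pair_def to_ratio_def)
qed

lemma cr_dom_spanI:
  assumes "\<omega> v1 v4 \<noteq> 0" "\<omega> v2 v3 \<noteq> 0"
  shows "(span {v1}, span {v2}, span {v3}, span {v4}) \<in> cr_dom"
proof -
  have n: "v1 \<noteq> 0" "v2 \<noteq> 0" "v3 \<noteq> 0" "v4 \<noteq> 0" using assms by auto
  have "span {v1} \<noteq> span {v4}" "span {v2} \<noteq> span {v3}"
    using span_eq_iff n assms by auto
  then show ?thesis unfolding cr_dom_def using n by (auto simp: proj_line_iff)
qed

text \<open>If both products vanish, two of the coincidences \<open>1 = 3\<close> or
  \<open>2 = 4\<close> and \<open>1 = 4\<close> or \<open>2 = 3\<close> of entries hold together,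
  and any such pair makes three entries equal.\<close>

lemma cr_dom_pair_nonzero:
  assumes "v1 \<noteq> 0" "v2 \<noteq> 0" "v3 \<noteq> 0" "v4 \<noteq> 0"
    "(span {v1}, span {v2}, span {v3}, span {v4}) \<in> cr_dom"
  shows "cr_pair (v1, v2, v3, v4) \<noteq> 0"
proof
  assume "cr_pair (v1, v2, v3, v4) = 0"
  then have "(\<omega> v1 v3 = 0 \<or> \<omega> v2 v4 = 0) \<and> (\<omega> v1 v4 = 0 \<or> \<omega> v2 v3 = 0)"
    by (simp add: cr_pair_def prod_eq_iff)
  then have "(span {v1} = span {v3} \<or> span {v2} = span {v4}) \<and>
      (span {v1} = span {v4} \<or> span {v2} = span {v3})"
    using span_eq_iff assms(1-4) by metis
  then show False using assms(5) by (auto simp: cr_dom_def)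
qed

lemma open_to_ratio_vimage:
  assumes V: "openin (Alexandroff_compactification euclideanreal) V"
  shows "open {z. z \<noteq> 0 \<and> to_ratio z \<in> V}"
proof -
  have op: "open {z::real \<times> real. snd z \<noteq> 0}"
    by (intro open_Collect_neq continuous_intros)
  have cont: "continuous_on {z::real \<times> real. snd z \<noteq> 0} (\<lambda>z. fst z / snd z)"
    by (intro continuous_intros) auto
  have pre: "open {z::real \<times> real. snd z \<noteq> 0 \<and> fst z / snd z \<in> T}" if "open T" for T
    using continuous_open_preimage[OF cont op that] by (simp add: Int_def)
  consider U where "open U" "V = Some ` U" | C where "compact C" "V = insert None (Some ` (- C))"
    using V by (auto simp: openin_Alexandroff_compactification Compl_eq_Diff_UNIV)
  then show ?thesis
  proof cases
    case 1
    then have "{z. z \<noteq> 0 \<and> to_ratio z \<in> V} = {z. snd z \<noteq> 0 \<and> fst z / snd z \<in> U}"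
      by (auto simp: to_ratio_def)
    then show ?thesis using pre[of U] 1 by simp
  next
    case 2
    \<comment> \<open>For a neighbourhood of infinity: as \<open>m\<close> bounds \<open>C\<close>,
      the open cone \<open>m * \<bar>snd z\<bar> < \<bar>fst z\<bar>\<close> is mapped outside
      \<open>C\<close> and contains all points with \<open>snd z = 0\<close> and
      \<open>z \<noteq> 0\<close>.\<close>
    obtain m where m: "m > 0" "\<And>x. x \<in> C \<Longrightarrow> \<bar>x\<bar> < m"
      using compact_imp_bounded[OF 2(1)] by (auto simp: bounded_pos_less)
    have "open {z::real \<times> real. m * \<bar>snd z\<bar> < \<bar>fst z\<bar>}"
      by (intro open_Collect_less continuous_intros)
    moreover have "open {z::real \<times> real. snd z \<noteq> 0 \<and> fst z / snd z \<in> - C}"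
      using 2 by (intro pre) (simp add: compact_imp_closed open_Compl)
    moreover have "{z. z \<noteq> 0 \<and> to_ratio z \<in> V} =
      {z. m * \<bar>snd z\<bar> < \<bar>fst z\<bar>} \<union> {z. snd z \<noteq> 0 \<and> fst z / snd z \<in> - C}"
    proof -
      have "fst z / snd z \<notin> C" if "m * \<bar>snd z\<bar> < \<bar>fst z\<bar>" "snd z \<noteq> 0" for z :: "real \<times> real"
        using m(2)[of "fst z / snd z"] that by (auto simp: divide_simps)
      then show ?thesis
        unfolding 2(2) to_ratio_def by (auto simp: prod_eq_iff)
    qed
    ultimately show ?thesis by (simp add: open_Un)
  qed
qed

abbreviation proj_topology4 :: "('a set \<times> 'a set \<times> 'a set \<times> 'a set) topology" where
  "proj_topology4 \<equiv> prod_topology proj_topology (prod_topology proj_topology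
     (prod_topology proj_topology proj_topology))"

lemma openin_proj_topology4:
  assumes "openin proj_topology4 O'" "(p1, p2, p3, p4) \<in> O'"
  obtains W1 W2 W3 W4 where "openin proj_topology W1" "openin proj_topology W2"
    "openin proj_topology W3" "openin proj_topology W4"
    "p1 \<in> W1" "p2 \<in> W2" "p3 \<in> W3" "p4 \<in> W4" "W1 \<times> W2 \<times> W3 \<times> W4 \<subseteq> O'"
proof -
  obtain W1 R1 where 1: "openin proj_topology W1" "p1 \<in> W1"
     "openin (prod_topology proj_topology (prod_topology proj_topology proj_topology)) R1"
     "(p2, p3, p4) \<in> R1" "W1 \<times> R1 \<subseteq> O'"
    using assms unfolding openin_prod_topology_alt[of _ _ O'] by blast
  obtain W2 R2 where 2: "openin proj_topology W2" "p2 \<in> W2"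
     "openin (prod_topology proj_topology proj_topology) R2" "(p3, p4) \<in> R2" "W2 \<times> R2 \<subseteq> R1"
    using 1(3,4) unfolding openin_prod_topology_alt[of _ _ R1] by blast
  obtain W3 W4 where 3: "openin proj_topology W3" "p3 \<in> W3" "openin proj_topology W4" "p4 \<in> W4"
      "W3 \<times> W4 \<subseteq> R2"
    using 2(3,4) unfolding openin_prod_topology_alt[of _ _ R2] by blast
  show ?thesis
    by (rule that[OF 1(1) 2(1) 3(1) 3(3) 1(2) 2(2) 3(2) 3(4)]) (use 1(5) 2(5) 3(5) in blast)
qed

lemma cr_dom_cases:
  assumes "x \<in> cr_dom"
  obtains z1 z2 z3 z4 where "z1 \<noteq> 0" "z2 \<noteq> 0" "z3 \<noteq> 0" "z4 \<noteq> 0"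
    "x = (span {plane_point z1}, span {plane_point z2}, span {plane_point z3}, span {plane_point z4})"
proof -
  obtain p1 p2 p3 p4 where x: "x = (p1, p2, p3, p4)" using prod_cases4 by blast
  then have "p1 \<in> proj_line" "p2 \<in> proj_line" "p3 \<in> proj_line" "p4 \<in> proj_line"
    using assms by (auto simp: cr_dom_def)
  then show ?thesis using that unfolding x proj_line_point by blast
qed

lemma cr_dom_sub: "cr_dom \<subseteq> topspace proj_topology4"
  by (auto simp: cr_dom_def topspace_proj_topology)

text \<open>On coordinate vectors the map is polynomial followed by \<open>to_ratio\<close>. An open
  box of such vectors projects to an open set of quadruples of points by
  \<open>open_proj\<close>.\<close>

lemma continuous_cr_lift:
  "continuous_map (subtopology proj_topology4 cr_dom)
     (Alexandroff_compactification euclideanreal) cr_lift"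
proof -
  let ?L = "\<lambda>z. span {plane_point z}"
  let ?X = "subtopology proj_topology4 cr_dom"
  have "openin ?X {x \<in> topspace ?X. cr_lift x \<in> V}"
    if V: "openin (Alexandroff_compactification euclideanreal) V" for V
  proof (subst openin_subopen, intro ballI)
    fix x assume "x \<in> {x \<in> topspace ?X. cr_lift x \<in> V}"
    then have x: "x \<in> cr_dom" "cr_lift x \<in> V" by auto
    obtain z1 z2 z3 z4 where z: "z1 \<noteq> 0" "z2 \<noteq> 0" "z3 \<noteq> 0" "z4 \<noteq> 0"
      "x = (?L z1, ?L z2, ?L z3, ?L z4)"
      using cr_dom_cases[OF x(1)] by blast
    define F where "F z = (case z of (z1, z2, z3, z4) \<Rightarrow> cr_pair (plane_point z1, plane_point z2, plane_point z3, plane_point z4))"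
      for z :: "(real \<times> real) \<times> (real \<times> real) \<times> (real \<times> real) \<times> (real \<times> real)"
    define \<Omega> where "\<Omega> = F -` {z. z \<noteq> 0 \<and> to_ratio z \<in> V}"
    have "open \<Omega>"
      unfolding \<Omega>_def F_def cr_pair_def case_prod_unfold \<omega>_def c_point
      by (intro open_vimage open_to_ratio_vimage[OF V]) (auto intro!: continuous_intros)
    moreover have "(z1, z2, z3, z4) \<in> \<Omega>"
      using x cr_lift_span cr_dom_pair_nonzero z by (simp add: \<Omega>_def F_def)
    ultimately obtain S1 R1 where 1: "open S1" "open R1" "(z1, z2, z3, z4) \<in> S1 \<times> R1" "S1 \<times> R1 \<subseteq> \<Omega>"
      by (rule open_prod_elim)
    then have "(z2, z3, z4) \<in> R1" by simp
    with 1(2) obtain S2 R2 where 2: "open S2" "open R2" "(z2, z3, z4) \<in> S2 \<times> R2" "S2 \<times> R2 \<subseteq> R1"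
      by (rule open_prod_elim)
    then have "(z3, z4) \<in> R2" by simp
    with 2(2) obtain S3 S4 where 3: "open S3" "open S4" "(z3, z4) \<in> S3 \<times> S4" "S3 \<times> S4 \<subseteq> R2"
      by (rule open_prod_elim)
    define Q where "Q = (?L ` (S1 - {0})) \<times> (?L ` (S2 - {0})) \<times> (?L ` (S3 - {0})) \<times> (?L ` (S4 - {0}))"
    have "openin proj_topology4 Q"
      unfolding Q_def using 1 2 3 by (simp add: openin_prod_Times_iff open_proj)
    then have "openin ?X (Q \<inter> cr_dom)"
      by (auto simp: openin_subtopology)
    moreover have "x \<in> Q \<inter> cr_dom" using x z 1 2 3 by (auto simp: Q_def)
    moreover have "Q \<inter> cr_dom \<subseteq> {x \<in> topspace ?X. cr_lift x \<in> V}"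
    proof
      fix y assume y: "y \<in> Q \<inter> cr_dom"
      then obtain y1 y2 y3 y4 where w: "y1 \<in> S1" "y1 \<noteq> 0" "y2 \<in> S2" "y2 \<noteq> 0"
        "y3 \<in> S3" "y3 \<noteq> 0" "y4 \<in> S4" "y4 \<noteq> 0" "y = (?L y1, ?L y2, ?L y3, ?L y4)"
        unfolding Q_def by blast
      then have "(y1, y2, y3, y4) \<in> \<Omega>" using 1(4) 2(4) 3(4) by blast
      then have "to_ratio (cr_pair (plane_point y1, plane_point y2, plane_point y3, plane_point y4)) \<in> V" by (simp add: \<Omega>_def F_def)
      then have "cr_lift y \<in> V" using cr_lift_span[of "plane_point y1" "plane_point y2" "plane_point y3" "plane_point y4"] y w by simp
      then show "y \<in> {x \<in> topspace ?X. cr_lift x \<in> V}" using y cr_dom_sub by auto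
    qed
    ultimately show "\<exists>T. openin ?X T \<and> x \<in> T \<and> T \<subseteq> {x \<in> topspace ?X. cr_lift x \<in> V}" by blast
  qed
  then show ?thesis
    by (auto simp: continuous_map_def topspace_Alexandroff_compactification Pi_iff
        intro: option.exhaust)
qed

section \<open>Uniqueness of the continuous extension of the cross-ratio\<close>

lemma openin_proj_avoid:
  fixes W :: "'a set set"
  assumes W: "openin proj_topology W" "p \<in> W" and F: "finite F"
  obtains p' where "p' \<in> W" "p' \<notin> F"
proof -
  obtain z where z: "z \<noteq> 0" "p = span {plane_point z}"
    using W by (metis openin_proj_iff proj_line_point subsetD)
  \<comment> \<open>Moving away from \<open>z\<close> perpendicularly never returns to the same line
    through the origin, so no point of the projective line is isolated.\<close>
  define g where "g t = z + t *\<^sub>R (- snd z, fst z)" for t :: real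
  have om: "\<omega> (plane_point (g s)) (plane_point (g t)) = (t - s) * ((fst z)\<^sup>2 + (snd z)\<^sup>2)" for s t
    by (simp add: \<omega>_def g_def algebra_simps power2_eq_square)
  have n: "(fst z)\<^sup>2 + (snd z)\<^sup>2 \<noteq> 0"
    using z by (auto simp: prod_eq_iff sum_power2_eq_zero_iff)
  have nz: "g t \<noteq> 0" for t using om[of t "t + 1"] n by (auto simp: point_eq_0[THEN iffD2])
  have inj: "inj (\<lambda>t. span {plane_point (g t)})"
    using om n nz span_eq_iff by (auto simp: inj_def)
  define T where "T = {t. span {plane_point (g t)} \<in> W}"
  have "T = g -` {z. z \<noteq> 0 \<and> span {plane_point z} \<in> W}" using nz by (auto simp: T_def)
  moreover have "open (g -` {z. z \<noteq> 0 \<and> span {plane_point z} \<in> W})"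
    unfolding g_def using W(1) openin_proj_iff by (intro open_vimage continuous_intros) blast
  ultimately have "open T" by simp
  moreover have "0 \<in> T" using W z by (simp add: T_def g_def flip: zero_prod_def)
  ultimately have "infinite T" using finite_imp_not_open by blast
  then have "infinite ((\<lambda>t. span {plane_point (g t)}) ` T)"
    using finite_imageD inj_on_subset[OF inj subset_UNIV] by blast
  then obtain p' where "p' \<in> (\<lambda>t. span {plane_point (g t)}) ` T" "p' \<notin> F"
    using infinite_imp_nonempty[OF Diff_infinite_finite[OF F]] by blast
  then show ?thesis using that by (auto simp: T_def)
qed

definition distinct4 :: "('a set \<times> 'a set \<times> 'a set \<times> 'a set) set" where
  "distinct4 = {(p1, p2, p3, p4). {p1, p2, p3, p4} \<subseteq> proj_line \<and> distinct [p1, p2, p3, p4]}"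

text \<open>The entries are moved in turn, each inside its neighbourhood and away from those already
  chosen. This density is what determines the extension by continuity.\<close>

lemma cr_dom_closure_distinct4:
  assumes "x \<in> cr_dom" shows "x \<in> subtopology proj_topology4 cr_dom closure_of distinct4"
  unfolding in_closure_of
proof (intro conjI allI impI)
  show "x \<in> topspace (subtopology proj_topology4 cr_dom)" using assms cr_dom_sub by auto
  fix T assume "x \<in> T \<and> openin (subtopology proj_topology4 cr_dom) T"
  then obtain O' where O': "openin proj_topology4 O'" "T = O' \<inter> cr_dom" "x \<in> O'"
    by (auto simp: openin_subtopology)
  obtain p1 p2 p3 p4 where "x = (p1, p2, p3, p4)" using prod_cases4 by blast
  then obtain W1 W2 W3 W4 where W: "openin proj_topology W1" "openin proj_topology W2"
    "openin proj_topology W3" "openin proj_topology W4"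
    "p1 \<in> W1" "p2 \<in> W2" "p3 \<in> W3" "p4 \<in> W4" "W1 \<times> W2 \<times> W3 \<times> W4 \<subseteq> O'"
    using openin_proj_topology4 O' by metis
  obtain q1 where q1: "q1 \<in> W1" by (rule that) (rule W)
  obtain q2 where q2: "q2 \<in> W2" "q2 \<notin> {q1}" using openin_proj_avoid[OF W(2) W(6), of "{q1}"] by blast
  obtain q3 where q3: "q3 \<in> W3" "q3 \<notin> {q1, q2}" using openin_proj_avoid[OF W(3) W(7), of "{q1, q2}"] by blast
  obtain q4 where q4: "q4 \<in> W4" "q4 \<notin> {q1, q2, q3}" using openin_proj_avoid[OF W(4) W(8), of "{q1, q2, q3}"] by blast
  have "(q1, q2, q3, q4) \<in> O'" using W q1 q2 q3 q4 by blast
  moreover have "{q1, q2, q3, q4} \<subseteq> proj_line"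
    using W q1 q2 q3 q4 unfolding openin_proj_iff by blast
  ultimately have "(q1, q2, q3, q4) \<in> distinct4 \<and> (q1, q2, q3, q4) \<in> T"
    using q2 q3 q4 O' by (auto simp: distinct4_def cr_dom_def)
  then show "\<exists>y. y \<in> distinct4 \<and> y \<in> T" by blast
qed

text \<open>Spanning vectors \<open>f1\<close>, \<open>f2\<close> of the last two points are
  rescaled by Cramer's rule so that \<open>f1 + f2 = v2\<close>; the first point, being different
  from \<open>span {f2}\<close>, then has the required form.\<close>

lemma distinct4_normal_form:
  assumes "x \<in> distinct4"
  obtains t f1 f2 where "\<omega> f1 f2 \<noteq> 0"
    "x = (span {f1 + t *\<^sub>R f2}, span {f1 + f2}, span {f1}, span {f2})"
proof -
  obtain p1 p2 p3 p4 where x: "x = (p1, p2, p3, p4)" using prod_cases4 by blast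
  then obtain v1 v2 v3 v4 where v: "v1 \<noteq> 0" "v2 \<noteq> 0" "v3 \<noteq> 0" "v4 \<noteq> 0"
    "p1 = span {v1}" "p2 = span {v2}" "p3 = span {v3}" "p4 = span {v4}"
    using assms by (auto simp: distinct4_def proj_line_iff)
  then have d: "\<omega> v1 v4 \<noteq> 0" "\<omega> v2 v3 \<noteq> 0" "\<omega> v2 v4 \<noteq> 0" "\<omega> v3 v4 \<noteq> 0" "\<omega> v3 v2 \<noteq> 0"
    using assms x span_eq_iff omega_swap[of v3 v2] by (auto simp: distinct4_def)
  define f1 where "f1 = (\<omega> v2 v4 / \<omega> v3 v4) *\<^sub>R v3"
  define f2 where "f2 = (\<omega> v3 v2 / \<omega> v3 v4) *\<^sub>R v4"
  have f2: "f1 + f2 = v2" unfolding f1_def f2_def using omega_expand[OF d(4)] by metis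
  have f12: "\<omega> f1 f2 \<noteq> 0" using d by (simp add: f1_def f2_def)
  have "span {f1} = p3" "span {f2} = p4"
    using d v unfolding f1_def f2_def by (simp_all add: span_singleton_scale)
  moreover have "span {f1 + (\<omega> f1 v1 / \<omega> v1 f2) *\<^sub>R f2} = p1"
  proof -
    have n: "\<omega> v1 f2 \<noteq> 0" using d by (simp add: f2_def)
    have "v1 = (\<omega> v1 f2 / \<omega> f1 f2) *\<^sub>R (f1 + (\<omega> f1 v1 / \<omega> v1 f2) *\<^sub>R f2)"
      using omega_expand[OF f12, of v1] n by (simp add: scaleR_add_right)
    then show ?thesis using span_singleton_scale n f12 v(5) by (metis divide_eq_0_iff)
  qed
  ultimately show ?thesis using that[OF f12] f2 x v by metis
qed

lemma normal_form_in_cr_dom: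
  assumes "\<omega> f1 f2 \<noteq> 0"
  shows "(span {f1 + t *\<^sub>R f2}, span {f1 + f2}, span {f1}, span {f2}) \<in> cr_dom"
  by (rule cr_dom_spanI) (use assms omega_swap[of f2 f1] in auto)

text \<open>The normalization fixes any candidate on the dense set \<open>distinct4\<close>, the
  Hausdorff property of the compactified line extends the agreement to \<open>cr_dom\<close>, and
  extensionality settles the rest.\<close>

lemma cross_ratio_eq: "cross_ratio = cr_lift"
  unfolding cross_ratio_def
proof (rule the_equality, intro conjI allI impI)
  show "cr_lift \<in> extensional cr_dom" by (auto simp: cr_lift_def)
  show "continuous_map (subtopology proj_topology4 cr_dom)
     (Alexandroff_compactification euclideanreal) cr_lift" by (rule continuous_cr_lift)
  show "cr_lift (span {f1 + t *\<^sub>R f2}, span {f1 + f2}, span {f1}, span {f2}) = Some t"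
    if "independent {f1, f2} \<and> f1 \<noteq> f2" for t f1 f2
  proof -
    have f: "\<omega> f1 f2 \<noteq> 0" using that independent_iff by blast
    then have n: "f1 \<noteq> 0" "f2 \<noteq> 0" "f1 + f2 \<noteq> 0" "f1 + t *\<^sub>R f2 \<noteq> 0"
      using omega_simps(8)[of f2] omega_simps(9)[of f1] omega_simps(1)[of f1 _ f2]
        omega_simps(5)[of t f2 f2] omega_simps(7)[of f2] by (metis add.right_neutral mult_zero_right)+
    show ?thesis
      using cr_lift_span[OF n(4,3,1,2) normal_form_in_cr_dom[OF f]] f omega_swap[of f2 f1]
      by (simp add: cr_pair_def to_ratio_def)
  qed
  note nf = this
  fix c :: "'a set \<times> 'a set \<times> 'a set \<times> 'a set \<Rightarrow> real option"
  assume c: "c \<in> extensional cr_dom \<and>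
     continuous_map (subtopology proj_topology4 cr_dom) (Alexandroff_compactification euclideanreal) c \<and>
     (\<forall>x e1 e2. independent {e1, e2} \<and> e1 \<noteq> e2 \<longrightarrow>
        c (span {e1 + x *\<^sub>R e2}, span {e1 + e2}, span {e1}, span {e2}) = Some x)"
  have H: "Hausdorff_space (Alexandroff_compactification euclideanreal)"
    by (simp add: Hausdorff_space_Alexandroff_compactification locally_compact_space_euclidean)
  have "c x = cr_lift x" if "x \<in> distinct4" for x
    using distinct4_normal_form[OF that] c nf unfolding independent_iff by metis
  then have "c x = cr_lift x" if "x \<in> cr_dom" for x
    using forall_in_closure_of_eq[OF cr_dom_closure_distinct4[OF that] H _ continuous_cr_lift] c
    by blast
  then show "c = cr_lift"
    using c by (intro extensionalityI[of _ cr_dom]) (auto simp: cr_lift_def)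
qed

lemma cross_ratio_span:
  assumes "\<omega> v1 v4 \<noteq> 0" "\<omega> v2 v3 \<noteq> 0"
  shows "cross_ratio (span {v1}, span {v2}, span {v3}, span {v4}) =
    Some (\<omega> v1 v3 * \<omega> v2 v4 / (\<omega> v1 v4 * \<omega> v2 v3))"
proof -
  have "v1 \<noteq> 0" "v2 \<noteq> 0" "v3 \<noteq> 0" "v4 \<noteq> 0" using assms by auto
  then show ?thesis
    unfolding cross_ratio_eq using cr_lift_span[OF _ _ _ _ cr_dom_spanI[OF assms]] assms
    by (simp add: cr_pair_def to_ratio_def)
qed

lemma C_infinity_spanI:
  assumes "\<omega> v1 v4 \<noteq> 0" "\<omega> v2 v3 \<noteq> 0"
  shows "(span {v1}, span {v2}, span {v3}, span {v4}) \<in> C_infinity"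
  using cr_dom_spanI[OF assms] cross_ratio_span[OF assms] by (simp add: C_infinity_def)

lemma C_zero_spanI:
  assumes "\<omega> v1 v4 \<noteq> 0" "\<omega> v2 v3 \<noteq> 0" "\<omega> v1 v3 \<noteq> 0" "\<omega> v2 v4 \<noteq> 0"
  shows "(span {v1}, span {v2}, span {v3}, span {v4}) \<in> C_zero"
  using cr_dom_spanI[OF assms(1,2)] cross_ratio_span[OF assms(1,2)] assms by (simp add: C_zero_def)

end

section \<open>Affine charts and arcs\<close>

lemma closed_segment_real_iff: "t \<in> closed_segment x y \<longleftrightarrow> 0 \<le> (y - t) * (t - x)" for x :: real
  by (auto simp: closed_segment_eq_real_ivl zero_le_mult_iff)

lemma open_segment_real_iff: "t \<in> open_segment x y \<longleftrightarrow> 0 < (y - t) * (t - x)" for x :: real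
  by (auto simp: open_segment_eq_real_ivl zero_less_mult_iff)

context plane_basis
begin

text \<open>The affine chart with \<open>span {e2}\<close> as its point at infinity. In the theorem
  \<open>e2\<close> spans a point outside \<open>U\<close>, so that \<open>U\<close> lies in the
  range of the chart.\<close>

definition \<phi> :: "real \<Rightarrow> 'a set" where "\<phi> t = span {e1 + t *\<^sub>R e2}"

lemma omega_e2_e1 [simp]: "\<omega> e2 e1 = - 1"
  using omega_swap[of e2 e1] by simp

lemma chart_nonzero [simp]: "e1 + t *\<^sub>R e2 \<noteq> 0"
  by (simp add: eq_0_iff)

lemma e_nonzero [simp]: "e1 \<noteq> 0" "e2 \<noteq> 0"
  by (simp_all add: eq_0_iff)

lemma phi_proj_line: "\<phi> t \<in> proj_line"
  unfolding proj_line_iff \<phi>_def using chart_nonzero by blast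

lemma phi_eq_iff [simp]: "\<phi> s = \<phi> t \<longleftrightarrow> s = t"
  unfolding \<phi>_def by (subst span_eq_iff) auto

lemma phi_not_infinity [simp]: "\<phi> t \<noteq> span {e2}"
  unfolding \<phi>_def by (subst span_eq_iff) auto

lemma phi_scale: "k \<noteq> 0 \<Longrightarrow> span {k *\<^sub>R (e1 + t *\<^sub>R e2)} = \<phi> t"
  unfolding \<phi>_def by (rule span_singleton_scale)

lemma proj_line_cases:
  assumes "p \<in> proj_line" obtains "p = span {e2}" | t where "p = \<phi> t"
proof -
  obtain v where v: "v \<noteq> 0" "p = span {v}" using assms by (auto simp: proj_line_iff)
  show ?thesis
  proof (cases "c1 v = 0")
    case True
    then have "p = span {e2}" using v span_eq_iff[of v e2] by (simp add: \<omega>_def)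
    then show ?thesis by (rule that)
  next
    case False
    then have "p = \<phi> (c2 v / c1 v)"
      unfolding \<phi>_def v(2) using v(1) by (subst span_eq_iff) (auto simp: \<omega>_def)
    then show ?thesis by (rule that)
  qed
qed

lemma openin_phi_image:
  assumes "open T" shows "openin proj_topology (\<phi> ` T)"
proof -
  have op: "open {z::real \<times> real. fst z \<noteq> 0}"
    by (intro open_Collect_neq continuous_intros)
  have "continuous_on {z::real \<times> real. fst z \<noteq> 0} (\<lambda>z. snd z / fst z)"
    by (intro continuous_intros) auto
  from continuous_open_preimage[OF this op assms]
  have "open {z::real \<times> real. fst z \<noteq> 0 \<and> snd z / fst z \<in> T}" by (simp add: Int_def)
  moreover have "{z. z \<noteq> 0 \<and> span {plane_point z} \<in> \<phi> ` T} = {z. fst z \<noteq> 0 \<and> snd z / fst z \<in> T}"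
  proof -
    have "span {plane_point z} = \<phi> t \<longleftrightarrow> fst z \<noteq> 0 \<and> snd z / fst z = t" if "z \<noteq> 0" for z t
      unfolding \<phi>_def using that
      by (subst span_eq_iff; cases "fst z = 0") (auto simp: \<omega>_def prod_eq_iff field_simps)
    then show ?thesis by (auto simp: image_iff prod_eq_iff)
  qed
  ultimately show ?thesis
    unfolding openin_proj_iff using phi_proj_line by auto
qed

lemma open_phi_vimage:
  assumes "openin proj_topology W" shows "open (\<phi> -` W)"
proof -
  have "plane_point (1, t) = e1 + t *\<^sub>R e2" for t by (simp add: plane_point_def)
  then have "\<phi> -` W = (\<lambda>t. (1, t)) -` {z. z \<noteq> 0 \<and> span {plane_point z} \<in> W}"
    by (auto simp: \<phi>_def prod_eq_iff)
  moreover have "open ((\<lambda>t. (1, t)) -` {z. z \<noteq> 0 \<and> span {plane_point z} \<in> W})"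
    using assms openin_proj_iff by (intro open_vimage continuous_intros) blast
  ultimately show ?thesis by simp
qed

lemma phi_homeomorphic: "homeomorphic_map euclideanreal (subtopology proj_topology (range \<phi>)) \<phi>"
proof (rule bijective_open_imp_homeomorphic_map)
  show "continuous_map euclideanreal (subtopology proj_topology (range \<phi>)) \<phi>"
    unfolding continuous_map_in_subtopology
    using open_phi_vimage phi_proj_line
    by (auto simp: continuous_map_def topspace_proj_topology vimage_def)
  show "open_map euclideanreal (subtopology proj_topology (range \<phi>)) \<phi>"
    using openin_phi_image by (auto simp: open_map_def openin_subtopology)
  show "\<phi> ` topspace euclideanreal = topspace (subtopology proj_topology (range \<phi>))"
    using phi_proj_line by (auto simp: topspace_proj_topology)
qed (auto intro: injI)

lemma compact_phi_vimage:
  assumes "compactin proj_topology K" "K \<subseteq> range \<phi>" shows "compact (\<phi> -` K)"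
proof -
  have "compactin (subtopology proj_topology (range \<phi>)) (\<phi> ` (\<phi> -` K))"
    using assms by (simp add: compactin_subtopology image_vimage_eq Int_absorb2)
  then show ?thesis
    using homeomorphic_map_compactness[OF phi_homeomorphic, of "\<phi> -` K"] by simp
qed

lemma openin_phi_prod_vimage:
  assumes "openin (prod_topology proj_topology proj_topology) W"
  shows "open {z. (\<phi> (fst z), \<phi> (snd z)) \<in> W}"
proof (rule open_prod_intro)
  fix z assume "z \<in> {z. (\<phi> (fst z), \<phi> (snd z)) \<in> W}"
  then have "(\<phi> (fst z), \<phi> (snd z)) \<in> W" by simp
  with assms obtain S T where ST: "openin proj_topology S" "openin proj_topology T"
    "\<phi> (fst z) \<in> S" "\<phi> (snd z) \<in> T" "S \<times> T \<subseteq> W"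
    unfolding openin_prod_topology_alt by meson
  show "\<exists>A B. open A \<and> open B \<and> z \<in> A \<times> B \<and> A \<times> B \<subseteq> {z. (\<phi> (fst z), \<phi> (snd z)) \<in> W}"
  proof (intro exI conjI)
    show "open (\<phi> -` S)" "open (\<phi> -` T)" using ST open_phi_vimage by blast+
    show "z \<in> \<phi> -` S \<times> \<phi> -` T" using ST(3,4) by (cases z) simp
    show "\<phi> -` S \<times> \<phi> -` T \<subseteq> {z. (\<phi> (fst z), \<phi> (snd z)) \<in> W}" using ST(5) by auto
  qed
qed

section \<open>The two arcs with given extremities\<close>

lemma omega_segment:
  "\<omega> (a *\<^sub>R v + b *\<^sub>R w) w = a * \<omega> v w" "\<omega> v (a *\<^sub>R v + b *\<^sub>R w) = b * \<omega> v w"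
  by simp_all

text \<open>Write \<open>z\<close> as a combination of \<open>v\<close> and \<open>w\<close> by
  Cramer's rule. Its line meets the segment iff the two coefficients do not have opposite signs;
  division by their sum then gives the point of the segment.\<close>

lemma span_in_segment_image_iff:
  assumes D: "\<omega> v w \<noteq> 0" and z: "z \<noteq> 0"
  shows "span {z} \<in> (\<lambda>x. span {x}) ` closed_segment v w \<longleftrightarrow> 0 \<le> \<omega> z w * \<omega> v z"
proof
  assume "span {z} \<in> (\<lambda>x. span {x}) ` closed_segment v w"
  then obtain u where u: "0 \<le> u" "u \<le> 1" "span {z} = span {(1 - u) *\<^sub>R v + u *\<^sub>R w}"
    by (auto simp: closed_segment_def)
  then have "z \<in> span {(1 - u) *\<^sub>R v + u *\<^sub>R w}" using span_base[of z "{z}"] by simp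
  then obtain k where k: "z = k *\<^sub>R ((1 - u) *\<^sub>R v + u *\<^sub>R w)" by (auto simp: span_singleton)
  have "\<omega> z w * \<omega> v z = (k * \<omega> v w)\<^sup>2 * ((1 - u) * u)"
    by (simp add: k power2_eq_square algebra_simps)
  then show "0 \<le> \<omega> z w * \<omega> v z" using u by simp
next
  assume *: "0 \<le> \<omega> z w * \<omega> v z"
  define a where "a = \<omega> z w / \<omega> v w"
  define b where "b = \<omega> v z / \<omega> v w"
  have zab: "z = a *\<^sub>R v + b *\<^sub>R w" unfolding a_def b_def by (rule omega_expand[OF D])
  have ab: "0 \<le> a * b" using * by (simp add: a_def b_def)
  have s: "a + b \<noteq> 0"
  proof
    assume "a + b = 0"
    then have "a * b = - (a * a)" by (simp add: add_eq_0_iff)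
    then have "a = 0" using ab by (auto simp: zero_le_mult_iff mult_less_0_iff le_less)
    then show False using zab z \<open>a + b = 0\<close> by auto
  qed
  define u where "u = b / (a + b)"
  have "0 \<le> u" "u \<le> 1"
    using s ab by (auto simp: u_def divide_simps zero_le_mult_iff)
  moreover have "span {z} = span {(1 - u) *\<^sub>R v + u *\<^sub>R w}"
  proof -
    have "(a + b) * (1 - u) = a" "(a + b) * u = b"
      using s by (simp_all add: u_def right_diff_distrib)
    then have "z = (a + b) *\<^sub>R ((1 - u) *\<^sub>R v + u *\<^sub>R w)"
      unfolding zab scaleR_add_right scaleR_scaleR by simp
    then show ?thesis using span_singleton_scale s by metis
  qed
  ultimately show "span {z} \<in> (\<lambda>x. span {x}) ` closed_segment v w"
    by (auto simp: closed_segment_def)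
qed

text \<open>Along the segment the coefficient of \<open>e1\<close> runs from \<open>\<alpha>\<close>
  to \<open>\<beta>\<close>. It has a zero, and the arc passes through the point at infinity,
  exactly when the signs differ.\<close>

lemma segment_image:
  assumes "x \<noteq> y" and ab: "\<alpha> \<noteq> 0" "\<beta> \<noteq> 0"
  shows "(\<lambda>z. span {z}) ` closed_segment (\<alpha> *\<^sub>R (e1 + x *\<^sub>R e2)) (\<beta> *\<^sub>R (e1 + y *\<^sub>R e2)) =
    (if 0 < \<alpha> * \<beta> then \<phi> ` closed_segment x y else proj_line - \<phi> ` open_segment x y)" (is "?A = ?R")
proof -
  let ?v = "\<alpha> *\<^sub>R (e1 + x *\<^sub>R e2)" and ?w = "\<beta> *\<^sub>R (e1 + y *\<^sub>R e2)"
  have D: "\<omega> ?v ?w \<noteq> 0" using assms by simp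
  have sub: "?A \<subseteq> proj_line"
  proof
    fix p assume "p \<in> ?A"
    then obtain z where z: "z \<in> closed_segment ?v ?w" "p = span {z}" by blast
    have "z \<noteq> 0"
    proof
      assume "z = 0"
      then obtain u where "(1 - u) *\<^sub>R ?v + u *\<^sub>R ?w = 0" using z by (auto simp: closed_segment_def)
      then have "\<omega> ((1 - u) *\<^sub>R ?v + u *\<^sub>R ?w) ?w = 0" "\<omega> ?v ((1 - u) *\<^sub>R ?v + u *\<^sub>R ?w) = 0"
        by (metis omega_simps(8), metis omega_simps(9))
      then have "(1 - u) * \<omega> ?v ?w = 0" "u * \<omega> ?v ?w = 0"
        unfolding omega_segment .
      then show False using D by auto
    qed
    then show "p \<in> proj_line" using z by (auto simp: proj_line_iff)
  qed
  have fin: "\<phi> t \<in> ?A \<longleftrightarrow> 0 \<le> \<alpha> * \<beta> * ((y - t) * (t - x))" for t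
    unfolding \<phi>_def by (subst span_in_segment_image_iff[OF D]) (simp_all add: algebra_simps)
  have inf: "span {e2} \<in> ?A \<longleftrightarrow> \<alpha> * \<beta> \<le> 0"
    by (subst span_in_segment_image_iff[OF D]) (simp_all add: algebra_simps)
  have "p \<in> ?A \<longleftrightarrow> p \<in> ?R" if "p \<in> proj_line" for p
    using that
  proof (cases rule: proj_line_cases)
    case 1
    have "span {e2} \<notin> \<phi> ` S" for S using phi_not_infinity by (metis imageE)
    moreover have "span {e2} \<in> proj_line" using that 1 by simp
    ultimately show ?thesis unfolding 1 inf by auto
  next
    case (2 t)
    have im: "\<phi> t \<in> \<phi> ` S \<longleftrightarrow> t \<in> S" for S by auto
    have "\<alpha> * \<beta> \<noteq> 0" using ab by simp
    then show ?thesis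
    proof (cases "0 < \<alpha> * \<beta>")
      case True
      then have "0 \<le> \<alpha> * \<beta> * ((y - t) * (t - x)) \<longleftrightarrow> 0 \<le> (y - t) * (t - x)"
        by (metis zero_le_mult_iff order_less_asym linorder_not_less)
      then show ?thesis unfolding 2 fin using True im by (simp add: closed_segment_real_iff)
    next
      case False
      then have "\<alpha> * \<beta> < 0" using \<open>\<alpha> * \<beta> \<noteq> 0\<close> by linarith
      then have "0 \<le> \<alpha> * \<beta> * ((y - t) * (t - x)) \<longleftrightarrow> \<not> 0 < (y - t) * (t - x)"
        by (metis linorder_not_less mult_less_0_iff zero_le_mult_iff order_less_asym)
      then show ?thesis unfolding 2 fin using False im phi_proj_line
        by (simp add: open_segment_real_iff)
    qed
  qed
  moreover have "?R \<subseteq> proj_line" using phi_proj_line by auto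
  ultimately show ?thesis using sub by blast
qed

text \<open>A spanning vector is unique up to a nonzero factor, and only the sign of the product of
  the two factors matters. The factors \<open>1, 1\<close> and \<open>1, -1\<close> realize the two
  arcs.\<close>

lemma closed_arc_phi_iff:
  assumes "x \<noteq> y"
  shows "closed_arc (\<phi> x) (\<phi> y) A \<longleftrightarrow>
    A = \<phi> ` closed_segment x y \<or> A = proj_line - \<phi> ` open_segment x y"
proof
  assume "closed_arc (\<phi> x) (\<phi> y) A"
  then obtain v w where vw: "\<phi> x = span {v}" "\<phi> y = span {w}" "\<omega> v w \<noteq> 0"
    "A = (\<lambda>x. span {x}) ` closed_segment v w"
    unfolding closed_arc_def using independent_iff by blast
  have "\<exists>k. k \<noteq> 0 \<and> v = k *\<^sub>R (e1 + t *\<^sub>R e2)" if "\<phi> t = span {v}" "v \<noteq> 0" for v t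
  proof -
    have "\<omega> (e1 + t *\<^sub>R e2) v = 0"
      using span_eq_iff[of "e1 + t *\<^sub>R e2" v] that by (simp add: \<phi>_def)
    then obtain k where "v = k *\<^sub>R (e1 + t *\<^sub>R e2)" using omega_0_imp_scale chart_nonzero by blast
    then show ?thesis using that by auto
  qed
  moreover have "v \<noteq> 0" "w \<noteq> 0" using vw(3) by auto
  ultimately obtain \<alpha> \<beta> where "\<alpha> \<noteq> 0" "v = \<alpha> *\<^sub>R (e1 + x *\<^sub>R e2)" "\<beta> \<noteq> 0" "w = \<beta> *\<^sub>R (e1 + y *\<^sub>R e2)"
    using vw(1,2) by metis
  then show "A = \<phi> ` closed_segment x y \<or> A = proj_line - \<phi> ` open_segment x y"
    using segment_image[OF assms] vw(4) by auto
next
  have *: "closed_arc (\<phi> x) (\<phi> y)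
      ((\<lambda>z. span {z}) ` closed_segment (1 *\<^sub>R (e1 + x *\<^sub>R e2)) (\<beta> *\<^sub>R (e1 + y *\<^sub>R e2)))"
    if "\<beta> \<noteq> 0" for \<beta>
    unfolding closed_arc_def
  proof (intro exI conjI)
    have "\<omega> (1 *\<^sub>R (e1 + x *\<^sub>R e2)) (\<beta> *\<^sub>R (e1 + y *\<^sub>R e2)) \<noteq> 0" using assms that by simp
    then show "independent {1 *\<^sub>R (e1 + x *\<^sub>R e2), \<beta> *\<^sub>R (e1 + y *\<^sub>R e2)}"
      "1 *\<^sub>R (e1 + x *\<^sub>R e2) \<noteq> \<beta> *\<^sub>R (e1 + y *\<^sub>R e2)"
      using independent_iff by blast+
    show "\<phi> x = span {1 *\<^sub>R (e1 + x *\<^sub>R e2)}" "\<phi> y = span {\<beta> *\<^sub>R (e1 + y *\<^sub>R e2)}"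
      using phi_scale[OF that] by (simp_all add: \<phi>_def)
  qed simp
  assume "A = \<phi> ` closed_segment x y \<or> A = proj_line - \<phi> ` open_segment x y"
  then show "closed_arc (\<phi> x) (\<phi> y) A"
    using *[of 1] *[of "-1"] segment_image[OF assms, of 1 1] segment_image[OF assms, of 1 "-1"]
    by auto
qed

text \<open>In homogeneous coordinates this is a strict quadratic inequality, which treats the point
  at infinity like any other point.\<close>

lemma openin_arc_complement:
  assumes "x \<noteq> y" shows "openin proj_topology (proj_line - \<phi> ` closed_segment x y)"
proof -
  let ?W = "proj_line - \<phi> ` closed_segment x y"
  let ?v = "e1 + x *\<^sub>R e2" and ?w = "e1 + y *\<^sub>R e2"
  have "z \<noteq> 0 \<and> span {plane_point z} \<in> ?W \<longleftrightarrow> \<omega> (plane_point z) ?w * \<omega> ?v (plane_point z) < 0" for z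
  proof (cases "z = 0")
    case True
    then show ?thesis by (simp add: point_eq_0[THEN iffD2])
  next
    case False
    have "span {plane_point z} \<in> proj_line" using False proj_line_point by blast
    moreover have D: "\<omega> ?v ?w \<noteq> 0" using assms by simp
    ultimately show ?thesis
      using False span_in_segment_image_iff[OF D, of "plane_point z"] segment_image[OF assms, of 1 1] by auto
  qed
  then have "{z. z \<noteq> 0 \<and> span {plane_point z} \<in> ?W} = {z. \<omega> (plane_point z) ?w * \<omega> ?v (plane_point z) < 0}" by blast
  moreover have "open \<dots>"
    unfolding \<omega>_def c_point by (intro open_Collect_less continuous_intros)
  ultimately show ?thesis unfolding openin_proj_iff by simp
qed

text \<open>The form \<open>\<omega> _ h\<close> vanishes exactly on \<open>span {h}\<close>, so
  \<open>w - e \<in> span {h}\<close> determines the factor of \<open>m\<close>.\<close>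

lemma sigma_map_span:
  assumes "\<omega> m h \<noteq> 0"
  shows "sigma_map (span {h}) e (span {m}) = (\<omega> e h / \<omega> m h) *\<^sub>R m"
  unfolding sigma_map_def
proof (rule the_equality)
  have n: "m \<noteq> 0" "h \<noteq> 0" using assms by auto
  have in_h: "w \<in> span {h} \<longleftrightarrow> \<omega> w h = 0" for w
    using in_span_iff[OF n(2)] omega_swap[of w h] by simp
  show "(\<omega> e h / \<omega> m h) *\<^sub>R m \<in> span {m} \<and> (\<omega> e h / \<omega> m h) *\<^sub>R m - e \<in> span {h}"
    using assms by (simp add: in_h span_base span_scale)
  fix w assume w: "w \<in> span {m} \<and> w - e \<in> span {h}"
  then obtain k where k: "w = k *\<^sub>R m" by (auto simp: span_singleton)
  with w have "k * \<omega> m h = \<omega> e h" by (simp add: in_h)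
  then show "w = (\<omega> e h / \<omega> m h) *\<^sub>R m" using k assms by (simp add: field_simps)
qed

lemma cross_ratio_phi:
  assumes "x \<noteq> t" "y \<noteq> z"
  shows "cross_ratio (\<phi> x, \<phi> y, \<phi> z, \<phi> t) = Some ((z - x) * (t - y) / ((t - x) * (z - y)))"
  using assms cross_ratio_span[of "e1 + x *\<^sub>R e2" "e1 + t *\<^sub>R e2" "e1 + y *\<^sub>R e2" "e1 + z *\<^sub>R e2"]
  by (simp add: \<phi>_def)

lemma C_phi:
  assumes "x \<noteq> t" "y \<noteq> z" "x \<noteq> z" "y \<noteq> t"
  shows "(\<phi> x, \<phi> y, \<phi> z, \<phi> t) \<in> C_zero \<inter> C_infinity"
  using assms C_zero_spanI[of "e1 + x *\<^sub>R e2" "e1 + t *\<^sub>R e2" "e1 + y *\<^sub>R e2" "e1 + z *\<^sub>R e2"]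
    C_infinity_spanI[of "e1 + x *\<^sub>R e2" "e1 + t *\<^sub>R e2" "e1 + y *\<^sub>R e2" "e1 + z *\<^sub>R e2"]
  by (simp add: \<phi>_def)

end

section \<open>The measure of a barycentric map\<close>

locale barycentric_chart = plane_basis e1 e2 + involutive_mean I b
  for e1 e2 :: "'a::real_vector" and I b +
  fixes B :: "'a set \<times> 'a set \<Rightarrow> 'a set" and W M :: "real \<Rightarrow> real"
  assumes B_phi: "\<And>x y. x \<in> I \<Longrightarrow> y \<in> I \<Longrightarrow> B (\<phi> x, \<phi> y) = \<phi> (b x y)"
    and arc_seg_phi: "\<And>x y. x \<in> I \<Longrightarrow> y \<in> I \<Longrightarrow> x \<noteq> y \<Longrightarrow>
      arc_seg B (\<phi> x) (\<phi> y) = \<phi> ` closed_segment x y"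
    and W_mono: "strict_mono_on I W" and W_cont: "continuous_on I W"
    and WM: "\<And>x y. x \<in> I \<Longrightarrow> y \<in> I \<Longrightarrow> (W y - W x) * b x y = M y - M x"
begin

text \<open>The vector mass of the oriented arc from \<open>x\<close> to \<open>y\<close>; it
  changes sign with the orientation, which makes it additive for points in any order.\<close>

definition incr :: "real \<Rightarrow> real \<Rightarrow> 'a" where
  "incr x y = (W y - W x) *\<^sub>R e1 + (M y - M x) *\<^sub>R e2"

lemma incr_eq: "x \<in> I \<Longrightarrow> y \<in> I \<Longrightarrow> incr x y = (W y - W x) *\<^sub>R (e1 + b x y *\<^sub>R e2)"
  using WM[of x y] by (simp add: incr_def scaleR_add_right)

lemma incr_add: "incr x y + incr y z = incr x z"
  by (simp add: incr_def plane_eq_iff)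

lemma incr_swap: "incr y x = - 1 *\<^sub>R incr x y"
  by (simp add: incr_def plane_eq_iff)

lemma incr_self [simp]: "incr x x = 0"
  by (simp add: incr_def)

lemma W_ne: "x \<in> I \<Longrightarrow> y \<in> I \<Longrightarrow> x \<noteq> y \<Longrightarrow> W y - W x \<noteq> 0"
  using W_inj[OF W_mono W_cont WM] by (auto simp: inj_on_def)

lemma span_incr: "x \<in> I \<Longrightarrow> y \<in> I \<Longrightarrow> x \<noteq> y \<Longrightarrow> span {incr x y} = B (\<phi> x, \<phi> y)"
  using W_ne[of x y] by (simp add: incr_eq phi_scale B_phi)

lemma incr_nonzero: "x \<in> I \<Longrightarrow> y \<in> I \<Longrightarrow> x \<noteq> y \<Longrightarrow> incr x y \<noteq> 0"
  using W_ne[of x y] by (simp add: incr_eq)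

lemma b_ne: "x \<in> I \<Longrightarrow> y \<in> I \<Longrightarrow> z \<in> I \<Longrightarrow> y \<noteq> z \<Longrightarrow> b x y \<noteq> b x z"
  using b_less_iff[of x y z] b_less_iff[of x z y] by (cases y z rule: linorder_cases) auto

text \<open>Since \<open>incr u v = incr u x + incr x v\<close>, the determinants of
  \<open>incr u v\<close> and of \<open>incr x v\<close> with \<open>incr u x\<close> coincide and
  cancel in the cross-ratio. For \<open>x = u\<close> or \<open>x = v\<close> one increment is zero
  and spans no point; the vector \<open>e1 + x *\<^sub>R e2\<close> replaces it.\<close>

lemma r_quad_incr:
  assumes I: "x \<in> I" "u \<in> I" "v \<in> I" and uv: "u \<noteq> v" and h: "\<omega> (incr u v) h \<noteq> 0"
  shows "r_quad B (span {h}) (\<phi> u) (\<phi> x) (\<phi> v) \<in> C_infinity \<and>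
    r_fun B (span {h}) (\<phi> u) (\<phi> x) (\<phi> v) = Some (\<omega> (incr x v) h / \<omega> (incr u v) h)"
proof -
  have diag: "B (\<phi> t, \<phi> t) = span {e1 + t *\<^sub>R e2}" if "t \<in> I" for t
    using B_phi[OF that that] b_diag[OF that] by (simp add: \<phi>_def)
  consider "x = u" | "x = v" | "x \<noteq> u" "x \<noteq> v" by blast
  then obtain v2 v3 where v23: "B (\<phi> x, \<phi> v) = span {v2}" "B (\<phi> u, \<phi> x) = span {v3}"
    "\<omega> v2 v3 \<noteq> 0" "\<omega> (incr u v) v3 * \<omega> v2 h = \<omega> v2 v3 * \<omega> (incr x v) h"
  proof cases
    case 1
    have "\<omega> (incr u v) (e1 + u *\<^sub>R e2) = (W v - W u) * (u - b u v)"
      using I by (simp add: incr_eq algebra_simps)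
    moreover have "b u v \<noteq> u" using b_ne[of u v u] b_diag I uv by auto
    ultimately have "\<omega> (incr u v) (e1 + u *\<^sub>R e2) \<noteq> 0" using W_ne[OF I(2,3) uv] by simp
    then show ?thesis
      using that[of "incr u v" "e1 + u *\<^sub>R e2"] 1 diag[OF I(2)] span_incr[OF I(2,3) uv] by simp
  next
    case 2
    have "\<omega> (e1 + v *\<^sub>R e2) (incr u v) = (W v - W u) * (b u v - v)"
      using I by (simp add: incr_eq algebra_simps)
    moreover have "b u v \<noteq> v" using b_ne[of v u v] b_diag b_comm[of u v] I uv by auto
    ultimately have "\<omega> (e1 + v *\<^sub>R e2) (incr u v) \<noteq> 0" using W_ne[OF I(2,3) uv] by simp
    then show ?thesis
      using that[of "e1 + v *\<^sub>R e2" "incr u v"] 2 diag[OF I(3)] span_incr[OF I(2,3) uv] by simp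
  next
    case 3
    have "\<omega> (incr x v) (incr u x) = (W v - W x) * ((W x - W u) * (b u x - b x v))"
      using I by (simp add: incr_eq algebra_simps)
    moreover have "b u x \<noteq> b x v" using b_ne[of x u v] b_comm[of u x] I uv by auto
    ultimately have "\<omega> (incr x v) (incr u x) \<noteq> 0"
      using W_ne[OF I(1,3)] W_ne[OF I(2,1)] 3 by simp
    moreover have "\<omega> (incr u v) (incr u x) = \<omega> (incr x v) (incr u x)"
      unfolding incr_add[of u x v, symmetric] by simp
    ultimately show ?thesis
      using that[of "incr x v" "incr u x"] 3 span_incr[OF I(1,3)] span_incr[OF I(2,1)] by simp
  qed
  have "r_quad B (span {h}) (\<phi> u) (\<phi> x) (\<phi> v) = (span {incr u v}, span {v2}, span {v3}, span {h})"
    using span_incr[OF I(2,3) uv] v23 by (simp add: r_quad_def)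
  then show ?thesis
    using C_infinity_spanI[OF h v23(3)] cross_ratio_span[OF h v23(3)] v23(3,4) h
    by (simp add: r_fun_def field_simps)
qed

text \<open>As a function of \<open>t\<close> the form is affine. A change of sign would put its
  root \<open>c2 h / c1 h\<close> into the interval \<open>I\<close>.\<close>

lemma chart_same_sign:
  assumes h: "\<And>t. t \<in> I \<Longrightarrow> \<omega> (e1 + t *\<^sub>R e2) h \<noteq> 0" and st: "s \<in> I" "t \<in> I"
  shows "\<omega> (e1 + s *\<^sub>R e2) h * \<omega> (e1 + t *\<^sub>R e2) h > 0"
proof (rule ccontr)
  assume neg: "\<not> ?thesis"
  have f: "\<omega> (e1 + t *\<^sub>R e2) h = c2 h - t * c1 h" for t by (simp add: \<omega>_def)
  have lt: "(c2 h - s * c1 h) * (c2 h - t * c1 h) < 0"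
    using neg h[OF st(1)] h[OF st(2)] unfolding f by (metis linorder_neqE_linordered_idom mult_eq_0_iff)
  have c: "c1 h \<noteq> 0"
  proof
    assume "c1 h = 0"
    then show False using lt by (simp add: mult_less_0_iff)
  qed
  have "(c2 h - s * c1 h) * (c2 h - t * c1 h) = (c1 h)\<^sup>2 * ((c2 h / c1 h - s) * (c2 h / c1 h - t))"
    using c by (simp add: field_simps power2_eq_square)
  then have "(c2 h / c1 h - s) * (c2 h / c1 h - t) < 0"
    using lt c by (simp add: mult_less_0_iff)
  then have "c2 h / c1 h \<in> {s..t} \<union> {t..s}" by (auto simp: mult_less_0_iff)
  then have "c2 h / c1 h \<in> I" using I_interval[of s t] I_interval[of t s] st by blast
  then show False using h[of "c2 h / c1 h"] c unfolding f by simp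
qed

text \<open>Let \<open>f\<close> be a linear form with kernel \<open>k\<close>, evaluated along the
  chart. The difference of the two cross-ratios is
  \<open>(y - x) * f u * f v / (f x * f y * (v - u))\<close>. All values of \<open>f\<close> on
  \<open>I\<close> have the same sign, so \<open>k\<close> drops out; \<open>ne\<close> provides a
  \<open>k\<close> that pins down the description in \<open>eps\<close>.\<close>

lemma eps_phi:
  assumes I: "x \<in> I" "y \<in> I" "u \<in> I" "v \<in> I" and uv: "u \<noteq> v" and ne: "proj_line - \<phi> ` I \<noteq> {}"
  shows "eps (\<phi> ` I) (\<phi> x) (\<phi> y) (\<phi> u) (\<phi> v) = sgn (y - x) * sgn (v - u)"
proof -
  have *: "sgn (the (cross_ratio (\<phi> x, \<phi> u, \<phi> v, k)) - the (cross_ratio (\<phi> y, \<phi> u, \<phi> v, k)))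
      = sgn (y - x) * sgn (v - u)" if k: "k \<in> proj_line - \<phi> ` I" for k
  proof -
    obtain h where h: "h \<noteq> 0" "k = span {h}" using k by (auto simp: proj_line_iff)
    let ?f = "\<lambda>t. \<omega> (e1 + t *\<^sub>R e2) h"
    have nz: "?f t \<noteq> 0" if "t \<in> I" for t
      using span_eq_iff[of "e1 + t *\<^sub>R e2" h] h k that by (auto simp: \<phi>_def)
    have uv': "\<omega> (e1 + u *\<^sub>R e2) (e1 + v *\<^sub>R e2) \<noteq> 0" using uv by simp
    have cr: "cross_ratio (\<phi> t, \<phi> u, \<phi> v, k) = Some ((v - t) * ?f u / (?f t * (v - u)))" if "t \<in> I" for t
      unfolding h(2) \<phi>_def using cross_ratio_span[OF nz[OF that] uv'] by simp
    have id: "(v - x) * ?f y - (v - y) * ?f x = (y - x) * ?f v"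
      by (simp add: \<omega>_def algebra_simps)
    have "(v - x) * ?f u / (?f x * (v - u)) - (v - y) * ?f u / (?f y * (v - u))
        = ?f u * ((v - x) * ?f y - (v - y) * ?f x) / (?f x * ?f y * (v - u))"
      using nz[OF I(1)] nz[OF I(2)] uv
      by (simp add: divide_simps del: omega_simps) (simp add: algebra_simps del: omega_simps)
    also have "\<dots> = (y - x) * (?f u * ?f v) / (?f x * ?f y * (v - u))"
      unfolding id by (simp add: ac_simps)
    finally have "sgn ((v - x) * ?f u / (?f x * (v - u)) - (v - y) * ?f u / (?f y * (v - u)))
        = sgn (y - x) * sgn (?f u * ?f v) / (sgn (?f x * ?f y) * sgn (v - u))"
      by (simp add: sgn_mult sgn_divide)
    also have "\<dots> = sgn (y - x) / sgn (v - u)"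
      using chart_same_sign[OF nz I(3,4)] chart_same_sign[OF nz I(1,2)] by simp
    also have "\<dots> = sgn (y - x) * sgn (v - u)"
      using uv by (simp add: sgn_if)
    finally show ?thesis using cr I by simp
  qed
  show ?thesis unfolding eps_def
    by (rule the_equality) (use * ne in auto)
qed

text \<open>If \<open>h\<close> spans \<open>q\<close>, then \<open>d_fun\<close> is the quotient of
  the values of \<open>\<omega> _ h\<close> at \<open>incr x y\<close> and \<open>incr u v\<close>,
  and \<open>sigma_map\<close> contributes the inverse quotient. Only signs remain, and that of
  \<open>v - u\<close> occurs twice. The equality is homogeneous, hence the free factor
  \<open>c\<close>, which the prescribed vector fixes later.\<close>

lemma star_eq_incr:
  assumes I: "x \<in> I" "y \<in> I" "u \<in> I" "v \<in> I" and xy: "x \<noteq> y" and uv: "u \<noteq> v"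
    and ne: "proj_line - \<phi> ` I \<noteq> {}"
    and q: "q \<in> proj_line" "B (\<phi> u, \<phi> v) \<noteq> q" "q \<noteq> B (\<phi> x, \<phi> y)"
  shows "star_eq B (\<phi> ` I) q (\<phi> x) (\<phi> y) (\<phi> u) (\<phi> v)
    ((c * sgn (y - x)) *\<^sub>R incr x y) ((c * sgn (v - u)) *\<^sub>R incr u v)"
proof -
  obtain h where h: "h \<noteq> 0" "q = span {h}" using q by (auto simp: proj_line_iff)
  have u0: "\<omega> (incr u v) h \<noteq> 0" and x0: "\<omega> (incr x y) h \<noteq> 0"
    using span_eq_iff[OF incr_nonzero[OF I(3,4) uv] h(1)] span_eq_iff[OF incr_nonzero[OF I(1,2) xy] h(1)]
      span_incr[OF I(3,4) uv] span_incr[OF I(1,2) xy] q h by auto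
  have d: "d_fun B q (\<phi> x) (\<phi> y) (\<phi> u) (\<phi> v) = \<omega> (incr x y) h / \<omega> (incr u v) h"
  proof -
    have "\<omega> (incr x v) h = \<omega> (incr x y) h + \<omega> (incr y v) h"
      unfolding incr_add[of x y v, symmetric] by simp
    then show ?thesis
      unfolding d_fun_def h(2) using r_quad_incr[OF I(1,3,4) uv u0] r_quad_incr[OF I(2,3,4) uv u0]
      by (simp add: diff_divide_distrib[symmetric])
  qed
  have s: "sigma_map q ((c * sgn (v - u)) *\<^sub>R incr u v) (B (\<phi> x, \<phi> y))
      = (c * sgn (v - u) * \<omega> (incr u v) h / \<omega> (incr x y) h) *\<^sub>R incr x y"
    unfolding h(2) span_incr[OF I(1,2) xy, symmetric] sigma_map_span[OF x0] by simp
  have "sgn (v - u) * sgn (v - u) = 1" using uv by (simp add: sgn_if)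
  then have "sgn (y - x) * sgn (v - u) * (\<omega> (incr x y) h / \<omega> (incr u v) h) *
     (c * sgn (v - u) * \<omega> (incr u v) h / \<omega> (incr x y) h) = c * sgn (y - x)"
    using u0 x0 by (simp add: field_simps)
  then show ?thesis
    unfolding star_eq_def d s eps_phi[OF I uv ne]
    using r_quad_incr[OF I(1,3,4) uv u0] r_quad_incr[OF I(2,3,4) uv u0] h(2) by simp
qed

section \<open>The measure on relatively compact Borel sets\<close>

definition trace :: "'a set set \<Rightarrow> real set" where
  "trace A = {s \<in> W ` I. \<phi> (inv_into I W s) \<in> A}"

text \<open>Integration in the parameter \<open>s = W x\<close>. As \<open>inv_into I W\<close> is
  arbitrary off the image of \<open>W\<close>, a trace is cut down to that image.\<close>

definition \<beta> :: "real \<Rightarrow> 'a set set \<Rightarrow> 'a" where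
  "\<beta> c A = c *\<^sub>R ((LINT s:trace A|lborel. 1) *\<^sub>R e1 + (LINT s:trace A|lborel. inv_into I W s) *\<^sub>R e2)"

lemma trace_phi_segment:
  assumes I: "x \<in> I" "y \<in> I" and xy: "x \<le> y"
  shows "trace (\<phi> ` {x..y}) = {W x..W y}"
proof -
  have "trace (\<phi> ` {x..y}) = W ` {x..y}"
    using I_interval[OF I] W_inj[OF W_mono W_cont WM] by (auto simp: trace_def image_iff)
  then show ?thesis using W_Icc_image[OF W_mono W_cont WM I xy] by simp
qed

text \<open>An arc does not remember the order of its extremities, an increment does;
  \<open>sgn (y - x)\<close> reconciles them.\<close>

lemma beta_arc:
  assumes I: "x \<in> I" "y \<in> I" and xy: "x \<noteq> y"
  shows "\<beta> c (arc_seg B (\<phi> x) (\<phi> y)) = (c * sgn (y - x)) *\<^sub>R incr x y"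
proof -
  have *: "\<beta> c (\<phi> ` {x..y}) = c *\<^sub>R incr x y" if "x \<in> I" "y \<in> I" "x < y" for x y
  proof -
    have "W x \<le> W y" using W_less_iff[OF W_mono W_cont WM that(1,2)] that(3) by simp
    then have "(LINT s:{W x..W y}|lborel. 1) = W y - W x"
      by (simp add: set_lebesgue_integral_def)
    then show ?thesis
      using trace_phi_segment[of x y] inv_W_integral[OF W_mono W_cont WM, of x y] that
      by (simp add: \<beta>_def incr_def)
  qed
  show ?thesis
  proof (cases "x < y")
    case True
    then show ?thesis using * I arc_seg_phi[OF I xy] by (simp add: closed_segment_eq_real_ivl)
  next
    case False
    then show ?thesis using *[of y x] I xy arc_seg_phi[OF I xy] incr_swap[of x y]
      by (simp add: closed_segment_eq_real_ivl)
  qed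
qed

lemma trace_borel:
  assumes "A \<in> sigma_sets (\<phi> ` I) {Q. openin proj_topology Q \<and> Q \<subseteq> \<phi> ` I}"
  shows "trace A \<in> sets lborel"
  using assms
proof induction
  case (Basic Q)
  then have "open (\<phi> -` Q)" using open_phi_vimage by simp
  then have "open (W ` I \<inter> inv_into I W -` (\<phi> -` Q))"
    using inv_W_cont[OF W_mono W_cont WM] open_W_image[OF W_mono W_cont WM]
    by (rule continuous_open_preimage[rotated 2])
  moreover have "trace Q = W ` I \<inter> inv_into I W -` (\<phi> -` Q)" by (auto simp: trace_def)
  ultimately show ?case by simp
next
  case Empty
  then show ?case by (simp add: trace_def)
next
  case (Compl A)
  have "trace (\<phi> ` I - A) = W ` I - trace A"
    using inv_W_in[OF W_mono W_cont WM] by (auto simp: trace_def)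
  then show ?case using Compl open_W_image[OF W_mono W_cont WM] by simp
next
  case (Union A)
  have "trace (\<Union>i. A i) = (\<Union>i. trace (A i))" by (auto simp: trace_def)
  then show ?case using Union by simp
qed

lemma trace_compact:
  assumes K: "compactin proj_topology K" "K \<subseteq> \<phi> ` I" shows "compact (trace K)"
proof -
  have "compact (\<phi> -` K)" using K by (intro compact_phi_vimage) auto
  moreover have "\<phi> -` K \<subseteq> I" using K by auto
  ultimately have "compact (W ` (\<phi> -` K))"
    using W_cont continuous_on_subset by (intro compact_continuous_image) blast
  moreover have "trace K = W ` (\<phi> -` K)"
    using \<open>\<phi> -` K \<subseteq> I\<close> W_inj[OF W_mono W_cont WM] by (auto simp: trace_def subset_iff)
  ultimately show ?thesis by simp
qed

text \<open>Relative compactness puts the trace inside a compact subset of the image of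
  \<open>W\<close>, where continuous functions are integrable; on the whole image they may be
  unbounded.\<close>

lemma trace_integrable:
  assumes A: "A \<in> bounded_borel (\<phi> ` I)" and f: "continuous_on (W ` I) f"
  shows "set_integrable lborel (trace A) (f :: real \<Rightarrow> real)"
proof -
  obtain K where K: "compactin proj_topology K" "A \<subseteq> K" "K \<subseteq> \<phi> ` I"
    and AB: "A \<in> sigma_sets (\<phi> ` I) {Q. openin proj_topology Q \<and> Q \<subseteq> \<phi> ` I}"
    using A by (auto simp: bounded_borel_def)
  have "continuous_on (trace K) f" using f by (rule continuous_on_subset) (auto simp: trace_def)
  then have "set_integrable lborel (trace K) f"
    unfolding set_integrable_def using trace_compact[OF K(1,3)] by (rule borel_integrable_compact[rotated])
  then show ?thesis
    by (rule set_integrable_subset) (use trace_borel[OF AB] K in \<open>auto simp: trace_def\<close>)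
qed

lemma vector_measure_beta: "vector_measure (\<phi> ` I) (\<beta> c)"
  unfolding vector_measure_def
proof (intro allI impI)
  fix A :: "nat \<Rightarrow> 'a set set" and f :: "'a \<Rightarrow> real"
  assume A: "range A \<subseteq> bounded_borel (\<phi> ` I) \<and> disjoint_family A \<and> (\<Union>n. A n) \<in> bounded_borel (\<phi> ` I)"
    and f: "linear f"
  have U: "trace (\<Union>n. A n) = (\<Union>n. trace (A n))" by (auto simp: trace_def)
  have disj: "disjoint_family (\<lambda>n. trace (A n))"
    using A by (auto simp: disjoint_family_on_def trace_def)
  have meas: "trace (A n) \<in> sets lborel" for n
    using A by (intro trace_borel) (auto simp: bounded_borel_def)
  have sums: "(\<lambda>n. LINT s:trace (A n)|lborel. g s) sums (LINT s:trace (\<Union>n. A n)|lborel. g s)"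
    if "continuous_on (W ` I) g" for g :: "real \<Rightarrow> real"
    unfolding U
    by (rule set_integral_sums[OF meas disj]) (use trace_integrable[OF _ that] A U in metis)
  \<comment> \<open>A linear form reduces the vector series to two scalar ones, for the densities
    \<open>1\<close> and \<open>inv_into I W\<close>.\<close>
  have f\<beta>: "f (\<beta> c S) = c * (LINT s:trace S|lborel. 1) * f e1
      + c * (LINT s:trace S|lborel. inv_into I W s) * f e2" for S
    by (simp add: \<beta>_def linear_add[OF f] linear_cmul[OF f] distrib_left)
  show "(\<lambda>n. f (\<beta> c (A n))) sums f (\<beta> c (\<Union>n. A n))"
    unfolding f\<beta>
    by (intro sums_add sums_mult sums_mult2 sums inv_W_cont[OF W_mono W_cont WM] continuous_intros)
qed

end

section \<open>The mean attached to \<open>B\<close> in an affine chart\<close>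

locale barycentric_function = plane_basis e1 e2 for e1 e2 :: "'a::real_vector" +
  fixes I :: "real set" and B :: "'a set \<times> 'a set \<Rightarrow> 'a set"
  assumes open_I: "open I" and conn_I: "connected I"
    and B_proj_line: "\<And>x y. x \<in> I \<Longrightarrow> y \<in> I \<Longrightarrow> B (\<phi> x, \<phi> y) \<in> proj_line"
    and B_comm: "\<And>x y. x \<in> I \<Longrightarrow> y \<in> I \<Longrightarrow> B (\<phi> x, \<phi> y) = B (\<phi> y, \<phi> x)"
    and B_ne: "\<And>x y. x \<in> I \<Longrightarrow> y \<in> I \<Longrightarrow> x \<noteq> y \<Longrightarrow>
      \<phi> x \<noteq> B (\<phi> x, \<phi> y) \<and> B (\<phi> x, \<phi> y) \<noteq> \<phi> y"
    and interior_arc: "\<And>x y r s. x \<in> I \<Longrightarrow> y \<in> I \<Longrightarrow> x \<noteq> y \<Longrightarrow>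
      r \<in> proj_topology interior_of (arc_seg B (\<phi> x) (\<phi> y)) \<Longrightarrow>
      s \<in> proj_topology interior_of (arc_seg B (\<phi> x) (\<phi> y)) \<Longrightarrow> r \<noteq> s \<Longrightarrow> r \<in> \<phi> ` I"
    and B_cross_ratio: "\<And>p q r s. p \<in> \<phi> ` I \<Longrightarrow> q \<in> \<phi> ` I \<Longrightarrow> r \<in> \<phi> ` I \<Longrightarrow> s \<in> \<phi> ` I \<Longrightarrow>
      (B (p, q), B (p, r), B (p, s), B (r, s)) \<in> C_zero \<inter> C_infinity \<Longrightarrow>
      (B (p, q), B (q, r), B (q, s), B (r, s)) \<in> C_zero \<inter> C_infinity \<Longrightarrow>
      cross_ratio (B (p, q), B (p, r), B (p, s), B (r, s)) =
      cross_ratio (B (p, q), B (q, r), B (q, s), B (r, s))"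
    and B_cont: "continuous_map (subtopology (prod_topology proj_topology proj_topology) (\<phi> ` I \<times> \<phi> ` I))
      proj_topology B"
begin

text \<open>
  If \<open>B (\<phi> x, \<phi> y)\<close> lay on the arc through the point at infinity, that point would belong
  to \<open>\<phi> ` I\<close> by the hypothesis on interiors of arcs.
\<close>

lemma B_arc:
  assumes I: "x \<in> I" "y \<in> I" and xy: "x \<noteq> y"
  shows "B (\<phi> x, \<phi> y) \<in> \<phi> ` open_segment x y" "arc_seg B (\<phi> x) (\<phi> y) = \<phi> ` closed_segment x y"
proof -
  let ?A1 = "\<phi> ` closed_segment x y" and ?A2 = "proj_line - \<phi> ` open_segment x y"
  let ?p = "B (\<phi> x, \<phi> y)"
  have int1: "\<phi> ` open_segment x y \<subseteq> proj_topology interior_of ?A1"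
    by (intro interior_of_maximal openin_phi_image image_mono segment_open_subset_closed)
      (simp add: open_segment_eq_real_ivl)
  have int2: "proj_line - ?A1 \<subseteq> proj_topology interior_of ?A2"
    by (intro interior_of_maximal openin_arc_complement xy) (auto simp: open_segment_def)
  note sub = interior_of_subset[of proj_topology ?A1] interior_of_subset[of proj_topology ?A2]
  have *: "?p \<in> \<phi> ` open_segment x y"
  proof (rule ccontr)
    assume n: "?p \<notin> \<phi> ` open_segment x y"
    then have n1: "?p \<notin> ?A1" using B_ne[OF I xy] by (auto simp: open_segment_def)
    then have "?p \<in> proj_topology interior_of ?A2" using int2 B_proj_line[OF I] by blast
    then have arc: "arc_seg B (\<phi> x) (\<phi> y) = ?A2"
      unfolding arc_seg_def closed_arc_phi_iff[OF xy] using sub(1) n1 by (intro the_equality) blast+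
    have inf: "span {e2} \<notin> \<phi> ` S" for S using phi_not_infinity by (metis imageE)
    have "span {e2} \<in> proj_line"
      unfolding proj_line_iff using e_nonzero(2) by blast
    then have "span {e2} \<in> proj_line - ?A1" using inf by blast
    \<comment> \<open>The hypothesis on arcs concerns two distinct interior points; a point beyond
      both extremities accompanies the point at infinity.\<close>
    moreover have "\<phi> (max x y + 1) \<in> proj_line - ?A1"
      using phi_proj_line by (auto simp: closed_segment_eq_real_ivl split: if_splits)
    ultimately have "span {e2} \<in> \<phi> ` I"
      using interior_arc[OF I xy, unfolded arc, of "span {e2}" "\<phi> (max x y + 1)"] int2
        phi_not_infinity[of "max x y + 1"] by (metis subsetD)
    then show False using inf by blast
  qed
  then show "?p \<in> \<phi> ` open_segment x y" .
  show "arc_seg B (\<phi> x) (\<phi> y) = ?A1"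
    unfolding arc_seg_def closed_arc_phi_iff[OF xy] using sub(2) int1 *
    by (intro the_equality) blast+
qed

lemma open_B_vimage:
  assumes "openin proj_topology Q" shows "open {z \<in> I \<times> I. B (\<phi> (fst z), \<phi> (snd z)) \<in> Q}"
proof -
  let ?PP = "prod_topology proj_topology (proj_topology :: 'a set topology)"
  let ?D = "\<phi> ` I \<times> \<phi> ` I"
  have D: "openin ?PP ?D" by (simp add: openin_prod_Times_iff openin_phi_image open_I)
  then have "?D \<subseteq> topspace ?PP" by (rule openin_subset)
  then have top: "topspace (subtopology ?PP ?D) = ?D" by (simp add: topspace_subtopology Int_absorb1)
  have "openin (subtopology ?PP ?D) {z \<in> ?D. B z \<in> Q}"
    using openin_continuous_map_preimage[OF B_cont assms] unfolding top .
  then have "openin ?PP {z \<in> ?D. B z \<in> Q}"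
    using D openin_open_subtopology by blast
  from openin_phi_prod_vimage[OF this]
  show ?thesis by (simp add: mem_Times_iff image_iff)
qed

text \<open>As \<open>t\<close> tends to \<open>x\<close>, \<open>B_arc\<close> confines
  \<open>B (\<phi> x, \<phi> t)\<close> to the shrinking arc between \<open>\<phi> x\<close> and
  \<open>\<phi> t\<close>, whereas continuity keeps it near \<open>B (\<phi> x, \<phi> x)\<close>.
  The argument stays on the projective line because the latter value could a priori be the point at
  infinity.\<close>

lemma B_diag: assumes x: "x \<in> I" shows "B (\<phi> x, \<phi> x) = \<phi> x"
proof (rule ccontr)
  assume n: "B (\<phi> x, \<phi> x) \<noteq> \<phi> x"
  obtain d where d: "d > 0" "B (\<phi> x, \<phi> x) \<notin> \<phi> ` closed_segment (x - d) (x + d)"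
  proof -
    from B_proj_line[OF x x] show thesis
    proof (cases rule: proj_line_cases)
      case 1
      then show thesis using that[of 1] phi_not_infinity by (metis imageE zero_less_one)
    next
      case (2 t)
      then have "t \<noteq> x" using n by auto
      then have "t \<notin> closed_segment (x - \<bar>t - x\<bar> / 2) (x + \<bar>t - x\<bar> / 2)"
        by (auto simp: closed_segment_eq_real_ivl abs_if field_simps)
      then have "B (\<phi> x, \<phi> x) \<notin> \<phi> ` closed_segment (x - \<bar>t - x\<bar> / 2) (x + \<bar>t - x\<bar> / 2)"
        unfolding 2 by auto
      then show thesis using that[of "\<bar>t - x\<bar> / 2"] \<open>t \<noteq> x\<close> by simp
    qed
  qed
  have "x - d \<noteq> x + d" using d by simp
  from open_B_vimage[OF openin_arc_complement[OF this]]
  have "open {z \<in> I \<times> I. B (\<phi> (fst z), \<phi> (snd z)) \<in> proj_line - \<phi> ` closed_segment (x - d) (x + d)}" (is "open ?S") .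
  then have "open ((\<lambda>t. (x, t)) -` ?S)"
    by (intro open_vimage continuous_intros)
  moreover have "x \<in> (\<lambda>t. (x, t)) -` ?S" using d B_proj_line x by simp
  ultimately obtain e where e: "e > 0" "\<And>t. dist t x < e \<Longrightarrow> (x, t) \<in> ?S"
    unfolding open_dist by (auto simp: vimage_def)
  define t where "t = x + min d (e / 2)"
  have t: "x < t" "t \<le> x + d" "dist t x < e" using d e by (auto simp: t_def dist_real_def min_def)
  have "(x, t) \<in> ?S" using e t by blast
  then have tI: "t \<in> I" "B (\<phi> x, \<phi> t) \<notin> \<phi> ` closed_segment (x - d) (x + d)" by auto
  have "open_segment x t \<subseteq> closed_segment (x - d) (x + d)"
    using t d by (auto simp: closed_segment_eq_real_ivl open_segment_eq_real_ivl)
  then show False using B_arc(1)[OF x tI(1)] t tI(2) by blast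
qed

definition b :: "real \<Rightarrow> real \<Rightarrow> real" where "b x y = inv \<phi> (B (\<phi> x, \<phi> y))"

lemma B_phi: assumes I: "x \<in> I" "y \<in> I" shows "B (\<phi> x, \<phi> y) = \<phi> (b x y)"
proof -
  have "B (\<phi> x, \<phi> y) \<in> range \<phi>"
    using B_arc(1)[OF I] B_diag[OF I(1)] by (cases "x = y") auto
  then show ?thesis by (simp add: b_def f_inv_into_f)
qed

text \<open>The seven inequalities are what \<open>C_phi\<close> asks of the two quadruples in H6.
  Their cross-ratios share the factor \<open>b r s - b p q\<close> in the denominator, and clearing
  denominators leaves the involution relation.\<close>

lemma involutive_mean_b: "involutive_mean I b"
proof
  show "open I" by (rule open_I)
  show "connected I" by (rule conn_I)
  show "continuous_on (I \<times> I) (\<lambda>(x, y). b x y)"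
  proof (subst continuous_on_open_vimage, intro open_Times open_I, intro allI impI)
    fix T :: "real set" assume "open T"
    have "(\<lambda>(x, y). b x y) -` T \<inter> I \<times> I = {z \<in> I \<times> I. B (\<phi> (fst z), \<phi> (snd z)) \<in> \<phi> ` T}"
      using B_phi by (auto simp: image_iff)
    then show "open ((\<lambda>(x, y). b x y) -` T \<inter> I \<times> I)"
      using open_B_vimage[OF openin_phi_image[OF \<open>open T\<close>]] by simp
  qed
  show "b x y = b y x" if "x \<in> I" "y \<in> I" for x y
    using B_comm that by (simp add: b_def)
  show "x < b x y \<and> b x y < y" if "x \<in> I" "y \<in> I" "x < y" for x y
    using B_arc(1)[OF that(1,2)] B_phi[OF that(1,2)] that(3)
    by (auto simp: open_segment_eq_real_ivl)
  fix p q r s assume I: "p \<in> I" "q \<in> I" "r \<in> I" "s \<in> I"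
    and n: "b p q \<noteq> b p s" "b p r \<noteq> b r s" "b p q \<noteq> b r s" "b p r \<noteq> b p s"
      "b p q \<noteq> b q s" "b q r \<noteq> b r s" "b q r \<noteq> b q s"
  have "\<phi> p \<in> \<phi> ` I" "\<phi> q \<in> \<phi> ` I" "\<phi> r \<in> \<phi> ` I" "\<phi> s \<in> \<phi> ` I" using I by auto
  from B_cross_ratio[OF this] C_phi[OF n(3,4,1,2)] C_phi[OF n(3,7,5,6)]
    cross_ratio_phi[OF n(3,4)] cross_ratio_phi[OF n(3,7)]
  have "(b p s - b p q) * (b r s - b p r) / ((b r s - b p q) * (b p s - b p r)) =
    (b q s - b p q) * (b r s - b q r) / ((b r s - b p q) * (b q s - b q r))"
    using I by (simp add: B_phi)
  then have "(b p s - b p q) * (b r s - b p r) * (b q s - b q r) =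
    (b q s - b p q) * (b r s - b q r) * (b p s - b p r)"
    using n(3,4,7) by (simp add: frac_eq_eq)
  then show "(b p q - b p s) * (b p r - b r s) * (b q r - b q s) =
      (b p q - b q s) * (b q r - b r s) * (b p r - b p s)"
    by (simp add: algebra_simps)
qed

end

text \<open>Any vector off the line \<open>k\<close> completes \<open>e2\<close> to a basis: a third
  independent vector would exceed the size of a spanning set with two elements.\<close>

lemma obtain_plane_basis:
  assumes dim: "dim (UNIV :: 'a::real_vector set) = 2" and k: "k \<in> (proj_line :: 'a set set)"
  obtains e1 e2 where "plane_basis e1 e2" "k = span {e2}"
proof -
  obtain e2 where e2: "e2 \<noteq> 0" "k = span {e2}" using k by (auto simp: proj_line_iff)
  have "span {e2} \<noteq> UNIV"
  proof
    assume "span {e2} = UNIV"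
    then have "dim (UNIV :: 'a set) = 1"
      using dim_span_eq_card_independent[of "{e2}"] e2 by simp
    then show False using dim by simp
  qed
  then obtain e1 where e1: "e1 \<notin> span {e2}" by blast
  then have ne: "e1 \<noteq> e2" by (auto simp: span_base)
  have ind: "independent {e1, e2}"
    using e1 e2 independent_insert[of e1 "{e2}"] by simp
  obtain S :: "'a set" where S: "independent S" "UNIV \<subseteq> span S" "card S = 2"
    using real_vector.basis_exists[of "UNIV :: 'a set"] dim by metis
  then have "finite S" using card.infinite by fastforce
  have "span {e1, e2} = UNIV"
  proof (rule ccontr)
    assume "span {e1, e2} \<noteq> UNIV"
    then obtain w where w: "w \<notin> span {e1, e2}" by blast
    then have "w \<notin> {e1, e2}" using span_base by blast
    then have "independent {w, e1, e2}" "card {w, e1, e2} = 3"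
      using w ind ne by (simp_all add: independent_insert[of w])
    then show False
      using independent_span_bound[OF \<open>finite S\<close>, of "{w, e1, e2}"] S by auto
  qed
  then show ?thesis using that e2 ind ne by (simp add: plane_basis_def)
qed

section \<open>Choice of the chart and normalization of the measure\<close>

theorem theorem7:
  fixes B :: "'a::real_vector set \<times> 'a set \<Rightarrow> 'a set"
    and D :: "('a set \<times> 'a set) set" and U :: "'a set set"
    and u0 v0 :: "'a set" and \<beta>0 :: 'a
  assumes dimE: "dim (UNIV :: 'a set) = 2"
    and D: "D \<noteq> {}" "openin (prod_topology proj_topology proj_topology) D"
    and B: "\<And>z. z \<in> D \<Longrightarrow> B z \<in> proj_line"
    and H1: "\<And>p q. (p, q) \<in> D \<Longrightarrow> (q, p) \<in> D"
    and H2: "\<And>p q r s. (p, q) \<in> D \<Longrightarrow> (r, s) \<in> D \<Longrightarrow> (p, r) \<in> D"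
    and H3: "\<And>p q. (p, q) \<in> D \<Longrightarrow> B (p, q) = B (q, p)"
    and H4: "\<And>p q. (p, q) \<in> D \<Longrightarrow> p \<noteq> q \<Longrightarrow> p \<noteq> B (p, q) \<and> B (p, q) \<noteq> q"
    and H5: "\<And>p q r s. (p, q) \<in> D \<Longrightarrow> p \<noteq> q \<Longrightarrow>
        r \<in> proj_topology interior_of (arc_seg B p q) \<Longrightarrow>
        s \<in> proj_topology interior_of (arc_seg B p q) \<Longrightarrow> r \<noteq> s \<Longrightarrow>
        (r, s) \<in> D \<and> arc_seg B r s \<subseteq> arc_seg B p q"
    and H6: "\<And>p q r s. (p, q) \<in> D \<Longrightarrow> (r, s) \<in> D \<Longrightarrow>
        (B (p, q), B (p, r), B (p, s), B (r, s)) \<in> C_zero \<inter> C_infinity \<Longrightarrow>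
        (B (p, q), B (q, r), B (q, s), B (r, s)) \<in> C_zero \<inter> C_infinity \<Longrightarrow>
        cross_ratio (B (p, q), B (p, r), B (p, s), B (r, s)) =
        cross_ratio (B (p, q), B (q, r), B (q, s), B (r, s))"
    and H7: "continuous_map (subtopology (prod_topology proj_topology proj_topology) D)
        proj_topology B"
    and U: "U \<noteq> {}" "openin proj_topology U" "connectedin proj_topology U"
        "U \<subset> proj_line" "D = U \<times> U"
    and uv0: "u0 \<in> U" "v0 \<in> U" "u0 \<noteq> v0"
    and \<beta>0: "\<beta>0 \<noteq> 0" "B (u0, v0) = span {\<beta>0}"
  shows "(\<forall>x\<in>U. \<forall>y\<in>U. x \<noteq> y \<longrightarrow>
            (\<exists>!b. \<forall>q\<in>proj_line. B (u0, v0) \<noteq> q \<and> q \<noteq> B (x, y) \<longrightarrow>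
                star_eq B U q x y u0 v0 b \<beta>0)) \<and>
         (\<exists>\<beta>. vector_measure U \<beta> \<and>
            \<beta> (arc_seg B u0 v0) = \<beta>0 \<and>
            (\<forall>x\<in>U. \<forall>y\<in>U. \<forall>u\<in>U. \<forall>v\<in>U. \<forall>q\<in>proj_line.
                x \<noteq> y \<and> u \<noteq> v \<and> B (u, v) \<noteq> q \<and> q \<noteq> B (x, y) \<longrightarrow>
                star_eq B U q x y u v (\<beta> (arc_seg B x y)) (\<beta> (arc_seg B u v))) \<and>
            (\<forall>x\<in>U. \<forall>y\<in>U. x \<noteq> y \<longrightarrow> \<beta> (arc_seg B x y) \<noteq> 0) \<and>
            (\<forall>z\<in>D. bary_map (arc_seg B) \<beta> z = B z))"
proof -
  \<comment> \<open>A point outside \<open>U\<close>, to be the point at infinity of the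
    chart.\<close>
  obtain k where k: "k \<in> proj_line" "k \<notin> U" using U(4) by blast
  obtain e1 e2 where "plane_basis e1 e2" and ke: "k = span {e2}"
    using obtain_plane_basis[OF dimE k(1)] .
  then interpret P: plane_basis e1 e2 by simp
  define I where "I = P.\<phi> -` U"
  have UI: "U = P.\<phi> ` I"
  proof -
    have "U \<subseteq> range P.\<phi>"
    proof
      fix p assume p: "p \<in> U"
      then have "p \<in> proj_line" using U(4) by blast
      then show "p \<in> range P.\<phi>"
        by (cases rule: P.proj_line_cases) (use p k(2) ke in auto)
    qed
    then show ?thesis unfolding I_def by auto
  qed
  have inI: "P.\<phi> x \<in> U \<longleftrightarrow> x \<in> I" for x by (simp add: I_def)
  have openI: "open I" unfolding I_def by (rule P.open_phi_vimage[OF U(2)])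
  have connI: "connected I"
    unfolding connected_def
  proof
    assume "\<exists>S T. open S \<and> open T \<and> I \<subseteq> S \<union> T \<and> S \<inter> T \<inter> I = {} \<and> S \<inter> I \<noteq> {} \<and> T \<inter> I \<noteq> {}"
    then obtain S T where "open S" "open T" "I \<subseteq> S \<union> T" "S \<inter> T \<inter> I = {}" "S \<inter> I \<noteq> {}" "T \<inter> I \<noteq> {}"
      by blast
    then have "openin proj_topology (P.\<phi> ` S)" "openin proj_topology (P.\<phi> ` T)"
      "U \<subseteq> P.\<phi> ` S \<union> P.\<phi> ` T" "P.\<phi> ` S \<inter> P.\<phi> ` T \<inter> U = {}" "P.\<phi> ` S \<inter> U \<noteq> {}" "P.\<phi> ` T \<inter> U \<noteq> {}"
      using P.openin_phi_image unfolding UI by auto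
    then show False using U(3) unfolding connectedin by blast
  qed
  interpret F: barycentric_function e1 e2 I B
  proof
    show "open I" by (rule openI)
    show "connected I" by (rule connI)
    show "B (P.\<phi> x, P.\<phi> y) \<in> proj_line" if "x \<in> I" "y \<in> I" for x y
      using B that U(5) inI by simp
    show "B (P.\<phi> x, P.\<phi> y) = B (P.\<phi> y, P.\<phi> x)" if "x \<in> I" "y \<in> I" for x y
      using H3 that U(5) inI by simp
    show "P.\<phi> x \<noteq> B (P.\<phi> x, P.\<phi> y) \<and> B (P.\<phi> x, P.\<phi> y) \<noteq> P.\<phi> y"
      if "x \<in> I" "y \<in> I" "x \<noteq> y" for x y
      using H4[of "P.\<phi> x" "P.\<phi> y"] that U(5) inI by simp
    show "r \<in> P.\<phi> ` I" if "x \<in> I" "y \<in> I" "x \<noteq> y"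
      "r \<in> proj_topology interior_of (arc_seg B (P.\<phi> x) (P.\<phi> y))"
      "s \<in> proj_topology interior_of (arc_seg B (P.\<phi> x) (P.\<phi> y))" "r \<noteq> s" for x y r s
      using H5[OF _ _ that(4,5,6)] that(1-3) U(5) inI UI by simp
    show "cross_ratio (B (p, q), B (p, r), B (p, s), B (r, s)) =
      cross_ratio (B (p, q), B (q, r), B (q, s), B (r, s))"
      if "p \<in> P.\<phi> ` I" "q \<in> P.\<phi> ` I" "r \<in> P.\<phi> ` I" "s \<in> P.\<phi> ` I"
        "(B (p, q), B (p, r), B (p, s), B (r, s)) \<in> C_zero \<inter> C_infinity"
        "(B (p, q), B (q, r), B (q, s), B (r, s)) \<in> C_zero \<inter> C_infinity" for p q r s
      using H6[OF _ _ that(5,6)] that(1-4) U(5) UI by simp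
    show "continuous_map (subtopology (prod_topology proj_topology proj_topology) (P.\<phi> ` I \<times> P.\<phi> ` I))
      proj_topology B" using H7 U(5) UI by simp
  qed
  interpret V: involutive_mean I F.b by (rule F.involutive_mean_b)
  obtain x0 y0 where xy0: "x0 \<in> I" "y0 \<in> I" "x0 \<noteq> y0" "u0 = P.\<phi> x0" "v0 = P.\<phi> y0"
    using uv0 unfolding UI by blast
  \<comment> \<open>The reference interval for \<open>W\<close> must have ordered extremities, while
    the coordinates of \<open>u0\<close> and \<open>v0\<close> may come in either order.\<close>
  then obtain x1 y1 where "x1 \<in> I" "y1 \<in> I" "x1 < y1" by (metis linorder_neqE_linordered_idom)
  then obtain W M where WM: "strict_mono_on I W" "continuous_on I W"
    "\<And>x y. x \<in> I \<Longrightarrow> y \<in> I \<Longrightarrow> (W y - W x) * F.b x y = M y - M x"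
    using V.exists_primitive by metis
  interpret C: barycentric_chart e1 e2 I F.b B W M
    using WM F.B_phi F.B_arc(2) by unfold_locales auto
  have "\<beta>0 \<in> span {C.incr x0 y0}"
    using \<beta>0(2) C.span_incr[OF xy0(1-3)] xy0(4,5) span_base[of \<beta>0 "{\<beta>0}"] by simp
  then obtain l where l: "\<beta>0 = l *\<^sub>R C.incr x0 y0" by (auto simp: span_singleton)
  \<comment> \<open>The sign cancels the one in \<open>beta_arc\<close>, so that the arc between
    \<open>u0\<close> and \<open>v0\<close> receives exactly \<open>\<beta>0\<close>.\<close>
  define c where "c = l * sgn (y0 - x0)"
  have "sgn (y0 - x0) * sgn (y0 - x0) = 1" using xy0(3) by (simp add: sgn_if)
  then have cl: "c * sgn (y0 - x0) = l" by (simp add: c_def mult.assoc)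
  have c0: "c \<noteq> 0" using cl l \<beta>0(1) by auto
  define \<beta> where "\<beta> = C.\<beta> c"
  have ne: "proj_line - P.\<phi> ` I \<noteq> {}" using k UI by blast
  have arc0: "\<beta> (arc_seg B u0 v0) = \<beta>0"
    unfolding \<beta>_def xy0(4,5) C.beta_arc[OF xy0(1-3)] cl l ..
  have star: "star_eq B U q x y u v (\<beta> (arc_seg B x y)) (\<beta> (arc_seg B u v))"
    if "x \<in> U" "y \<in> U" "u \<in> U" "v \<in> U" "q \<in> proj_line" "x \<noteq> y" "u \<noteq> v" "B (u, v) \<noteq> q" "q \<noteq> B (x, y)"
    for x y u v q
  proof -
    obtain x' y' u' v' where I: "x' \<in> I" "y' \<in> I" "u' \<in> I" "v' \<in> I"
      and eq: "x = P.\<phi> x'" "y = P.\<phi> y'" "u = P.\<phi> u'" "v = P.\<phi> v'"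
      using \<open>x \<in> U\<close> \<open>y \<in> U\<close> \<open>u \<in> U\<close> \<open>v \<in> U\<close> unfolding UI by blast
    have "x' \<noteq> y'" "u' \<noteq> v'" using that eq by auto
    then show ?thesis
      using C.star_eq_incr[OF I _ _ ne \<open>q \<in> proj_line\<close>, of c] C.beta_arc[OF I(1,2), of c]
        C.beta_arc[OF I(3,4), of c] that(8,9)
      unfolding \<beta>_def eq UI by simp
  qed
  have span_beta: "B (x, y) = span {\<beta> (arc_seg B x y)} \<and> \<beta> (arc_seg B x y) \<noteq> 0"
    if xy: "x \<in> U" "y \<in> U" "x \<noteq> y" for x y
  proof -
    obtain x' y' where I: "x' \<in> I" "y' \<in> I" and eq: "x = P.\<phi> x'" "y = P.\<phi> y'"
      using xy unfolding UI by blast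
    have xy': "x' \<noteq> y'" using xy eq by auto
    then have "c * sgn (y' - x') \<noteq> 0" using c0 by (simp add: sgn_if)
    from span_singleton_scale[OF this, of "C.incr x' y'"] this show ?thesis
      unfolding \<beta>_def eq C.beta_arc[OF I xy']
      using C.span_incr[OF I xy'] C.incr_nonzero[OF I xy'] by simp
  qed
  have unique: "\<exists>!b. \<forall>q\<in>proj_line. B (u0, v0) \<noteq> q \<and> q \<noteq> B (x, y) \<longrightarrow> star_eq B U q x y u0 v0 b \<beta>0"
    if "x \<in> U" "y \<in> U" "x \<noteq> y" for x y
  proof (rule ex1I)
    show "\<forall>q\<in>proj_line. B (u0, v0) \<noteq> q \<and> q \<noteq> B (x, y) \<longrightarrow>
        star_eq B U q x y u0 v0 (\<beta> (arc_seg B x y)) \<beta>0"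
      using star[OF that(1,2) uv0(1,2) _ that(3) uv0(3)] unfolding arc0 by blast
    \<comment> \<open>The condition on \<open>b\<close> quantifies over \<open>q\<close>; uniqueness
      requires one admissible \<open>q\<close>, for which the equality already determines
      \<open>b\<close>.\<close>
    have "openin proj_topology (proj_line :: 'a set set)"
      using openin_topspace[of proj_topology] unfolding topspace_proj_topology .
    then obtain q where q: "q \<in> proj_line" "q \<notin> {B (u0, v0), B (x, y)}"
      using P.openin_proj_avoid[of proj_line k "{B (u0, v0), B (x, y)}"] k(1) by blast
    fix b assume "\<forall>q\<in>proj_line. B (u0, v0) \<noteq> q \<and> q \<noteq> B (x, y) \<longrightarrow> star_eq B U q x y u0 v0 b \<beta>0"
    then have "star_eq B U q x y u0 v0 b \<beta>0" using q by auto
    moreover have "star_eq B U q x y u0 v0 (\<beta> (arc_seg B x y)) \<beta>0"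
      using star[OF that(1,2) uv0(1,2) q(1) that(3) uv0(3)] q(2) unfolding arc0 by auto
    ultimately show "b = \<beta> (arc_seg B x y)" by (simp add: star_eq_def)
  qed
  have bary: "bary_map (arc_seg B) \<beta> z = B z" if "z \<in> D" for z
  proof -
    obtain x y where z: "z = (x, y)" "x \<in> U" "y \<in> U" using \<open>z \<in> D\<close> U(5) by blast
    show ?thesis
    proof (cases "x = y")
      case True
      obtain t where "t \<in> I" "x = P.\<phi> t" using z unfolding UI by blast
      then show ?thesis using F.B_diag True z by (simp add: bary_map_def)
    next
      case False
      then show ?thesis using span_beta[OF z(2,3)] z by (simp add: bary_map_def)
    qed
  qed
  have measure: "vector_measure U \<beta>" unfolding \<beta>_def UI by (rule C.vector_measure_beta)
  show ?thesis
  proof (intro conjI exI[of _ \<beta>] ballI impI unique measure arc0 bary)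
    fix x y u v q
    assume "x \<in> U" "y \<in> U" "u \<in> U" "v \<in> U" "q \<in> proj_line"
      "x \<noteq> y \<and> u \<noteq> v \<and> B (u, v) \<noteq> q \<and> q \<noteq> B (x, y)"
    then show "star_eq B U q x y u v (\<beta> (arc_seg B x y)) (\<beta> (arc_seg B u v))"
      by (elim conjE) (rule star)
  next
    fix x y assume "x \<in> U" "y \<in> U" "x \<noteq> y"
    then show "\<beta> (arc_seg B x y) \<noteq> 0" by (rule span_beta[THEN conjunct2])
  qed
qed

end
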